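(* Internal column insertion $\mathcal{C}$ is a bijection between the set of pairs $(P,Q)$ of tableaux sharing an inner border and the set of pairs $(T,U)$ of tableaux sharing an outer border, with $\mathcal{C}\circ\mathcal{C}$ the identity, such that if $\mathcal{C}(P,Q)=(T,U)$ then $P$ is Knuth-equivalent to $T$ and $Q$ is Knuth-equivalent to $U$, the outer border of $P$ equals the inner border of $U$, and the outer border of $Q$ equals the inner border of $T$. Furthermore, two tableaux are $\mathcal{C}$-dual equivalent if and only if they are dual equivalent (i.e. $\mathcal{J}$-dual equivalent).
   Context: A shape is a finite weakly decreasing sequence of integers (possibly negative) of fixed length $m$, ordered componentwise; $\beta/\alpha$ is a horizontal strip if $\beta_i\geq\alpha_i\geq\beta_{i+1}$ for all $i$. A tableau is a chain $\alpha=\beta^0\subseteq\cdots\subseteq\beta^k=\beta$ of shapes with horizontal-strip differences (its shape is $\beta/\alpha$, inner border $\alpha$, outer border $\beta$); adding a large constant to all parts turns it into an ordinary column-strict skew tableau. Local rule $\mathcal{C}$: for $\alpha,\beta,\gamma$ with $\beta/\alpha,\gamma/\alpha$ horizontal strips, $\delta=\mathcal{C}(\alpha;\beta,\gamma)$ is given by $d_m=0$; for $i=m,\dots,2$: $\delta_i=\min\{\beta_i+\gamma_i+d_i-\alpha_i,\alpha_{i-1}\}$, $d_{i-1}=\max\{\beta_i+\gamma_i+d_i-\alpha_i-\alpha_{i-1},0\}$; $\delta_1=\beta_1+\gamma_1+d_1-\alpha_1$. Given $\beta,\gamma,\delta$ with $\delta/\beta,\delta/\gamma$ horizontal strips there is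 a unique $\alpha$ with $\mathcal{C}(\alpha;\beta,\gamma)=\delta$. A growth diagram is an array of shapes whose rows and columns are tableaux, rows of common content, columns of common content. Internal column insertion: for $P,Q$ sharing an inner border, write $P$ across the first row and $Q$ down the first column, fill in by $\mathcal{C}$, and let $T$ be the last row and $U$ the last column; for $P,Q$ sharing an outer border write them across the last row and down the last column, fill in by the reverse rule, and let $T$ be the first row and $U$ the first column; set $\mathcal{C}(P,Q)=(T,U)$. The passage $P\mapsto T$ is a $\mathcal{C}$-move applied to $P$; two tableaux of the same shape are $\mathcal{C}$-dual equivalent if the same sequence of $\mathcal{C}$-moves applied to both always gives tableaux of the same shape. Jeu de taquin slides: the empty box at an inner corner repeatedly interchanges with its right or lower neighbour (the smaller, the lower if equal) until reaching an outer corner; reverse slides are also slides. Knuth-equivalence: related by a sequence of slides. Dual equivalence ($\mathcal{J}$-dual equivalence): same shape, and any same sequence of slides yields tableaux of the same shape. *)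

theory Defs
  imports Main
begin

text \<open>
  Shapes with \<open>m\<close> parts are integer lists of length \<open>m\<close>. Rows are numbered
  \<open>0, \<dots>, m - 1\<close> from the top, so \<open>s ! i\<close> is the part usually written with index \<open>i + 1\<close>.
\<close>

type_synonym shape = "int list"
type_synonym tableau = "shape list"

definition is_shape :: "nat \<Rightarrow> shape \<Rightarrow> bool" where
  "is_shape m s \<longleftrightarrow> length s = m \<and> sorted_wrt (\<ge>) s"

definition horizontal_strip :: "shape \<Rightarrow> shape \<Rightarrow> bool" where
  "horizontal_strip \<alpha> \<beta> \<longleftrightarrow> length \<alpha> = length \<beta> \<and>
     (\<forall>i < length \<beta>. \<alpha> ! i \<le> \<beta> ! i) \<and>
     (\<forall>i. Suc i < length \<beta> \<longrightarrow> \<beta> ! Suc i \<le> \<alpha> ! i)"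

definition is_tableau :: "nat \<Rightarrow> tableau \<Rightarrow> bool" where
  "is_tableau m P \<longleftrightarrow> P \<noteq> [] \<and> (\<forall>s \<in> set P. is_shape m s) \<and> successively horizontal_strip P"

abbreviation inner_border :: "tableau \<Rightarrow> shape" where
  "inner_border P \<equiv> hd P"

abbreviation outer_border :: "tableau \<Rightarrow> shape" where
  "outer_border P \<equiv> last P"

definition same_shape :: "tableau \<Rightarrow> tableau \<Rightarrow> bool" where
  "same_shape P Q \<longleftrightarrow> inner_border P = inner_border Q \<and> outer_border P = outer_border Q"


section \<open>Internal column insertion\<close>

text \<open>
  \<open>carry \<alpha> \<beta> \<gamma> i\<close> is the number \<open>d\<close> passed up into row \<open>i\<close> from the rows below it;
  it vanishes in the bottom row.
\<close>

function carry :: "shape \<Rightarrow> shape \<Rightarrow> shape \<Rightarrow> nat \<Rightarrow> int" where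
  "carry \<alpha> \<beta> \<gamma> i =
     (if Suc i < length \<alpha>
      then max (\<beta> ! Suc i + \<gamma> ! Suc i + carry \<alpha> \<beta> \<gamma> (Suc i) - \<alpha> ! Suc i - \<alpha> ! i) 0
      else 0)"
  by pat_completeness auto
termination
  by (relation "measure (\<lambda>(\<alpha>, \<beta>, \<gamma>, i). length \<alpha> - i)") auto

declare carry.simps [simp del]

definition local_rule :: "shape \<Rightarrow> shape \<Rightarrow> shape \<Rightarrow> shape" where
  "local_rule \<alpha> \<beta> \<gamma> =
     map (\<lambda>i. let s = \<beta> ! i + \<gamma> ! i + carry \<alpha> \<beta> \<gamma> i - \<alpha> ! i
              in if i = 0 then s else min s (\<alpha> ! (i - 1)))
         [0..<length \<alpha>]"

definition reverse_local_rule :: "shape \<Rightarrow> shape \<Rightarrow> shape \<Rightarrow> shape" where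
  "reverse_local_rule \<beta> \<gamma> \<delta> =
     (THE \<alpha>. is_shape (length \<delta>) \<alpha> \<and> horizontal_strip \<alpha> \<beta> \<and> horizontal_strip \<alpha> \<gamma> \<and>
             local_rule \<alpha> \<beta> \<gamma> = \<delta>)"

text \<open>
  \<open>fill r P Q i j\<close> is the entry in row \<open>i\<close> and column \<open>j\<close> of the array with first row \<open>P\<close> and
  first column \<open>Q\<close> whose remaining entries are obtained from the rule \<open>r\<close>, applied to the
  diagonal, the vertical and the horizontal neighbour.
\<close>

fun fill :: "(shape \<Rightarrow> shape \<Rightarrow> shape \<Rightarrow> shape) \<Rightarrow> tableau \<Rightarrow> tableau \<Rightarrow> nat \<Rightarrow> nat \<Rightarrow> shape" where
  "fill r P Q 0 j = P ! j"
| "fill r P Q (Suc i) 0 = Q ! Suc i"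
| "fill r P Q (Suc i) (Suc j) =
     r (fill r P Q i j) (fill r P Q i (Suc j)) (fill r P Q (Suc i) j)"

definition last_row :: "(shape \<Rightarrow> shape \<Rightarrow> shape \<Rightarrow> shape) \<Rightarrow> tableau \<Rightarrow> tableau \<Rightarrow> tableau" where
  "last_row r P Q = map (\<lambda>j. fill r P Q (length Q - 1) j) [0..<length P]"

definition last_col :: "(shape \<Rightarrow> shape \<Rightarrow> shape \<Rightarrow> shape) \<Rightarrow> tableau \<Rightarrow> tableau \<Rightarrow> tableau" where
  "last_col r P Q = map (\<lambda>i. fill r P Q i (length P - 1)) [0..<length Q]"

text \<open>
  Internal column insertion is given by one procedure on pairs sharing an inner border and by
  another one on pairs sharing an outer border. They are kept as two functions,
  because a pair may share both borders. The second one fills the array from its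
  last row and column backwards, that is, it fills the array rotated by a half-turn.
\<close>

definition column_insert :: "tableau \<times> tableau \<Rightarrow> tableau \<times> tableau" where
  "column_insert = (\<lambda>(P, Q). (last_row local_rule P Q, last_col local_rule P Q))"

definition reverse_column_insert :: "tableau \<times> tableau \<Rightarrow> tableau \<times> tableau" where
  "reverse_column_insert = (\<lambda>(P, Q).
     let r = (\<lambda>\<delta> \<gamma> \<beta>. reverse_local_rule \<beta> \<gamma> \<delta>)
     in (rev (last_row r (rev P) (rev Q)), rev (last_col r (rev P) (rev Q))))"

definition inner_pairs :: "nat \<Rightarrow> (tableau \<times> tableau) set" where
  "inner_pairs m =
     {(P, Q). is_tableau m P \<and> is_tableau m Q \<and> inner_border P = inner_border Q}"

definition outer_pairs :: "nat \<Rightarrow> (tableau \<times> tableau) set" where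
  "outer_pairs m =
     {(P, Q). is_tableau m P \<and> is_tableau m Q \<and> outer_border P = outer_border Q}"

datatype insertion_move = Insert tableau | Reverse_Insert tableau

fun insertion_step :: "nat \<Rightarrow> insertion_move \<Rightarrow> tableau \<Rightarrow> tableau \<Rightarrow> bool" where
  "insertion_step m (Insert Q) P T \<longleftrightarrow>
     (P, Q) \<in> inner_pairs m \<and> T = fst (column_insert (P, Q))"
| "insertion_step m (Reverse_Insert Q) P T \<longleftrightarrow>
     (P, Q) \<in> outer_pairs m \<and> T = fst (reverse_column_insert (P, Q))"


section \<open>Jeu de taquin\<close>

text \<open>
  A box is a pair of a row number and an (integer) column number; row \<open>i\<close> of a shape \<open>s\<close> consists
  of the boxes \<open>(i, j)\<close> with \<open>j \<le> s ! i\<close>. The entry of a box of a tableau is the number of the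
  step of the chain in which the box is added.
\<close>

type_synonym box = "nat \<times> int"
type_synonym filling = "box \<Rightarrow> nat option"

definition filling_of :: "tableau \<Rightarrow> filling" where
  "filling_of P = (\<lambda>(i, j).
     if i < length (inner_border P) \<and> inner_border P ! i < j \<and> j \<le> outer_border P ! i
     then Some (LEAST k. j \<le> P ! k ! i) else None)"

definition inner_corner :: "shape \<Rightarrow> box \<Rightarrow> bool" where
  "inner_corner \<alpha> c \<longleftrightarrow> fst c < length \<alpha> \<and> snd c = \<alpha> ! fst c \<and>
     (Suc (fst c) < length \<alpha> \<longrightarrow> \<alpha> ! Suc (fst c) < \<alpha> ! fst c)"

definition remove_box :: "box \<Rightarrow> shape \<Rightarrow> shape" where
  "remove_box c s = s[fst c := snd c - 1]"

text \<open>
  \<open>jdt c f e g\<close>: moving the empty box from \<open>c\<close> through the filling \<open>f\<close> takes it to \<open>e\<close>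
  and leaves the filling \<open>g\<close>.
\<close>

inductive jdt :: "box \<Rightarrow> filling \<Rightarrow> box \<Rightarrow> filling \<Rightarrow> bool" where
  stop: "f (i, j + 1) = None \<Longrightarrow> f (Suc i, j) = None \<Longrightarrow> jdt (i, j) f (i, j) f"
| right: "f (i, j + 1) = Some x \<Longrightarrow> (\<And>y. f (Suc i, j) = Some y \<Longrightarrow> x < y) \<Longrightarrow>
     jdt (i, j + 1) (f((i, j) := Some x, (i, j + 1) := None)) e g \<Longrightarrow> jdt (i, j) f e g"
| down: "f (Suc i, j) = Some y \<Longrightarrow> (\<And>x. f (i, j + 1) = Some x \<Longrightarrow> y \<le> x) \<Longrightarrow>
     jdt (Suc i, j) (f((i, j) := Some y, (Suc i, j) := None)) e g \<Longrightarrow> jdt (i, j) f e g"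

text \<open>
  \<open>slide m c e P P'\<close>: the slide of \<open>P\<close> starting at the inner corner \<open>c\<close> ends at the outer
  corner \<open>e\<close> and yields \<open>P'\<close>.
\<close>

definition slide :: "nat \<Rightarrow> box \<Rightarrow> box \<Rightarrow> tableau \<Rightarrow> tableau \<Rightarrow> bool" where
  "slide m c e P P' \<longleftrightarrow> is_tableau m P \<and> is_tableau m P' \<and> length P' = length P \<and>
     inner_corner (inner_border P) c \<and>
     jdt c (filling_of P) e (filling_of P') \<and>
     inner_border P' = remove_box c (inner_border P) \<and>
     outer_border P' = remove_box e (outer_border P)"

text \<open>A slide is specified by the initial position of its empty box.\<close>

datatype slide_move = Slide box | Reverse_Slide box

fun slide_step :: "nat \<Rightarrow> slide_move \<Rightarrow> tableau \<Rightarrow> tableau \<Rightarrow> bool" where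
  "slide_step m (Slide c) P P' \<longleftrightarrow> (\<exists>e. slide m c e P P')"
| "slide_step m (Reverse_Slide e) P P' \<longleftrightarrow> (\<exists>c. slide m c e P' P)"


section \<open>Equivalences\<close>

inductive steps :: "('move \<Rightarrow> tableau \<Rightarrow> tableau \<Rightarrow> bool) \<Rightarrow> 'move list \<Rightarrow> tableau \<Rightarrow> tableau \<Rightarrow> bool"
  for step where
  Nil: "steps step [] P P"
| Cons: "step a P P' \<Longrightarrow> steps step as P' P'' \<Longrightarrow> steps step (a # as) P P''"

definition dual_equivalent_by ::
    "('move \<Rightarrow> tableau \<Rightarrow> tableau \<Rightarrow> bool) \<Rightarrow> tableau \<Rightarrow> tableau \<Rightarrow> bool" where
  "dual_equivalent_by step P Q \<longleftrightarrow> same_shape P Q \<and>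
     (\<forall>as P' Q'. steps step as P P' \<longrightarrow> steps step as Q Q' \<longrightarrow> same_shape P' Q')"

definition C_dual_equivalent :: "nat \<Rightarrow> tableau \<Rightarrow> tableau \<Rightarrow> bool" where
  "C_dual_equivalent m = dual_equivalent_by (insertion_step m)"

definition dual_equivalent :: "nat \<Rightarrow> tableau \<Rightarrow> tableau \<Rightarrow> bool" where
  "dual_equivalent m = dual_equivalent_by (slide_step m)"

definition Knuth_equivalent :: "nat \<Rightarrow> tableau \<Rightarrow> tableau \<Rightarrow> bool" where
  "Knuth_equivalent m P Q \<longleftrightarrow> (\<exists>as. steps (slide_step m) as P Q)"

end

theory Submission
  imports Defs
begin

text \<open>
  The local rule is inverted row by row, so a growth diagram is determined by its first row and
  column as well as by its last row and column; this gives the bijection.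

  Everything else is reduced to single boxes. Let \<open>P\<close> have inner border \<open>\<alpha>\<close>. Sliding \<open>P\<close> into the
  corners of all \<open>m\<close> rows, from the bottom row to the top one, translates \<open>P\<close> by one column to the
  left. Leaving out row \<open>r\<close> yields the same translate of the tableau obtained from \<open>P\<close> by internal
  insertion of a box in row \<open>r\<close>. Dually, inserting boxes into all rows from the top to the bottom
  translates \<open>P\<close> to the right, and leaving out row \<open>r\<close> yields the translate of the slide of \<open>P\<close>
  that starts in row \<open>r\<close>. The rows in which these moves begin depend only on \<open>r\<close>, and the rows in
  which they end only on the row in which the simulated move ends. Hence an insertion move is
  composed of slides, and an equivalence relation on tableaux respects slides, forwards and
  backwards, iff it respects insertion moves.
\<close>

section \<open>The local rule\<close>

text \<open>A simulation of one kind of move by the other is a zigzag: \<open>P\<close> and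
  \<open>T\<close> are not joined by one directed sequence of moves, but both lead to a common
  translate \<open>X\<close>. Hence relations have to be respected in both directions
  (\<open>closed_under\<close>), and both the start rows and the end rows of moves have to be
  controlled: the former to follow a sequence of moves, the latter to come back along it.
  Translating by slides in every row works because shapes have a fixed number of rows and arbitrary
  integer parts. Sequences of moves are never compared directly. Each of the two dual equivalences
  is the largest relation that preserves borders and is respected by its own moves, so it is enough
  to see that each is respected by the moves of the other kind. The remaining obstacle is that an
  insertion move adds whole strips; these are split into boxes in an order for which the rows can be
  recovered from the borders on either side.\<close>

lemma is_shape_iff_nth:
  "is_shape m s \<longleftrightarrow> length s = m \<and> (\<forall>i. Suc i < m \<longrightarrow> s ! Suc i \<le> s ! i)"
proof -
  have "transp ((\<ge>) :: int \<Rightarrow> int \<Rightarrow> bool)" by (auto simp: transp_def)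
  then show ?thesis
    by (auto simp: is_shape_def sorted_wrt_iff_nth_Suc_transp)
qed

lemma is_shape_length: "is_shape m s \<Longrightarrow> length s = m"
  by (simp add: is_shape_def)

lemma horizontal_strip_refl: "is_shape m s \<Longrightarrow> horizontal_strip s s"
  by (auto simp: horizontal_strip_def is_shape_iff_nth)

lemma carry_nonneg: "0 \<le> carry \<alpha> \<beta> \<gamma> i"
  by (subst carry.simps) simp

lemma carry_bottom: "length \<alpha> \<le> Suc i \<Longrightarrow> carry \<alpha> \<beta> \<gamma> i = 0"
  by (subst carry.simps) simp

lemma carry_step:
  "Suc i < length \<alpha> \<Longrightarrow> carry \<alpha> \<beta> \<gamma> i =
     max (\<beta> ! Suc i + \<gamma> ! Suc i + carry \<alpha> \<beta> \<gamma> (Suc i) - \<alpha> ! Suc i - \<alpha> ! i) 0"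
  by (subst carry.simps) simp

lemma length_local_rule [simp]: "length (local_rule \<alpha> \<beta> \<gamma>) = length \<alpha>"
  by (simp add: local_rule_def)

lemma nth_local_rule_0:
  "0 < length \<alpha> \<Longrightarrow> local_rule \<alpha> \<beta> \<gamma> ! 0 = \<beta> ! 0 + \<gamma> ! 0 + carry \<alpha> \<beta> \<gamma> 0 - \<alpha> ! 0"
  by (simp add: local_rule_def Let_def)

lemma nth_local_rule_Suc:
  "Suc i < length \<alpha> \<Longrightarrow> local_rule \<alpha> \<beta> \<gamma> ! Suc i =
     min (\<beta> ! Suc i + \<gamma> ! Suc i + carry \<alpha> \<beta> \<gamma> (Suc i) - \<alpha> ! Suc i) (\<alpha> ! i)"
  by (simp add: local_rule_def Let_def)

lemma carry_commute: "carry \<alpha> \<beta> \<gamma> i = carry \<alpha> \<gamma> \<beta> i"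
proof (induction "length \<alpha> - i" arbitrary: i)
  case 0
  then show ?case by (simp add: carry_bottom)
next
  case (Suc n)
  show ?case
  proof (cases "Suc i < length \<alpha>")
    case True
    with Suc show ?thesis by (simp add: carry_step add.commute)
  next
    case False
    then show ?thesis by (simp add: carry_bottom)
  qed
qed

lemma local_rule_commute: "local_rule \<alpha> \<beta> \<gamma> = local_rule \<alpha> \<gamma> \<beta>"
proof -
  have "(\<lambda>i. carry \<alpha> \<beta> \<gamma> i) = (\<lambda>i. carry \<alpha> \<gamma> \<beta> i)"
    by (rule ext) (rule carry_commute)
  then show ?thesis
    unfolding local_rule_def by (simp add: add.commute)
qed

section \<open>Interlacing shapes and single squares of the local rule\<close>

definition shape_strip :: "nat \<Rightarrow> shape \<Rightarrow> shape \<Rightarrow> bool" where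
  "shape_strip m \<alpha> \<beta> \<longleftrightarrow> is_shape m \<alpha> \<and> is_shape m \<beta> \<and> horizontal_strip \<alpha> \<beta>"

text \<open>The chain \<open>\<alpha> ! Suc i \<le> \<beta> ! Suc i \<le> \<alpha> ! i \<le> \<beta>
  ! i\<close> contains the monotonicity of both sequences.\<close>

lemma shape_strip_iff_nth:
  "shape_strip m \<alpha> \<beta> \<longleftrightarrow> length \<alpha> = m \<and> length \<beta> = m \<and>
     (\<forall>i < m. \<alpha> ! i \<le> \<beta> ! i) \<and> (\<forall>i. Suc i < m \<longrightarrow> \<beta> ! Suc i \<le> \<alpha> ! i)"
proof
  assume "shape_strip m \<alpha> \<beta>"
  then show "length \<alpha> = m \<and> length \<beta> = m \<and>
     (\<forall>i < m. \<alpha> ! i \<le> \<beta> ! i) \<and> (\<forall>i. Suc i < m \<longrightarrow> \<beta> ! Suc i \<le> \<alpha> ! i)"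
    by (auto simp: shape_strip_def is_shape_def horizontal_strip_def)
next
  assume strip: "length \<alpha> = m \<and> length \<beta> = m \<and>
     (\<forall>i < m. \<alpha> ! i \<le> \<beta> ! i) \<and> (\<forall>i. Suc i < m \<longrightarrow> \<beta> ! Suc i \<le> \<alpha> ! i)"
  have "\<alpha> ! Suc i \<le> \<alpha> ! i \<and> \<beta> ! Suc i \<le> \<beta> ! i" if "Suc i < m" for i
  proof -
    have "\<alpha> ! Suc i \<le> \<beta> ! Suc i" "\<beta> ! Suc i \<le> \<alpha> ! i" "\<alpha> ! i \<le> \<beta> ! i"
      using strip that by auto
    then show ?thesis by linarith
  qed
  with strip show "shape_strip m \<alpha> \<beta>"
    by (simp add: shape_strip_def is_shape_iff_nth horizontal_strip_def)
qed

text \<open>Neutral as to the direction of computation: the predicate holds whether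
  \<open>\<delta>\<close> or \<open>\<alpha>\<close> was computed from the other three shapes, so
  one notion of growth diagram serves both insertion procedures.\<close>

definition growth_square :: "nat \<Rightarrow> shape \<Rightarrow> shape \<Rightarrow> shape \<Rightarrow> shape \<Rightarrow> bool" where
  "growth_square m \<alpha> \<beta> \<gamma> \<delta> \<longleftrightarrow> shape_strip m \<alpha> \<beta> \<and> shape_strip m \<alpha> \<gamma> \<and>
     shape_strip m \<beta> \<delta> \<and> shape_strip m \<gamma> \<delta> \<and> \<delta> = local_rule \<alpha> \<beta> \<gamma>"

lemma growth_square_commute: "growth_square m \<alpha> \<beta> \<gamma> \<delta> \<longleftrightarrow> growth_square m \<alpha> \<gamma> \<beta> \<delta>"
  by (auto simp: growth_square_def local_rule_commute)

lemma growth_squareD: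
  assumes "growth_square m \<alpha> \<beta> \<gamma> \<delta>"
  shows "shape_strip m \<alpha> \<beta>" "shape_strip m \<alpha> \<gamma>" "shape_strip m \<beta> \<delta>" "shape_strip m \<gamma> \<delta>"
    "\<delta> = local_rule \<alpha> \<beta> \<gamma>"
  using assms unfolding growth_square_def by blast+

text \<open>Both terms of the minimum in row \<open>Suc k\<close> are at least
  \<open>\<beta> ! Suc k\<close>: the first because \<open>\<gamma>\<close> contains
  \<open>\<alpha>\<close> and carries are nonnegative, the second because
  \<open>\<beta>/\<alpha>\<close> is a strip. The second term also gives the upper bound, by
  \<open>\<alpha> ! k \<le> \<beta> ! k\<close>.\<close>

lemma shape_strip_local_rule:
  assumes "shape_strip m \<alpha> \<beta>" "shape_strip m \<alpha> \<gamma>"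
  shows "shape_strip m \<beta> (local_rule \<alpha> \<beta> \<gamma>)"
proof -
  have len: "length \<alpha> = m" "length \<beta> = m" "length \<gamma> = m"
    using assms by (auto simp: shape_strip_iff_nth)
  have lo: "\<beta> ! i \<le> local_rule \<alpha> \<beta> \<gamma> ! i" if "i < m" for i
  proof (cases i)
    case 0
    then show ?thesis
      using that assms carry_nonneg[of \<alpha> \<beta> \<gamma> 0] len
      by (simp add: nth_local_rule_0 shape_strip_iff_nth) smt
  next
    case (Suc k)
    have "\<alpha> ! i \<le> \<gamma> ! i" "\<beta> ! Suc k \<le> \<alpha> ! k"
      using that assms Suc by (auto simp: shape_strip_iff_nth)
    then show ?thesis
      using that Suc carry_nonneg[of \<alpha> \<beta> \<gamma> i] len by (simp add: nth_local_rule_Suc)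
  qed
  have hi: "local_rule \<alpha> \<beta> \<gamma> ! Suc i \<le> \<beta> ! i" if "Suc i < m" for i
  proof -
    have "\<alpha> ! i \<le> \<beta> ! i"
      using that assms by (auto simp: shape_strip_iff_nth)
    then show ?thesis using that len by (simp add: nth_local_rule_Suc)
  qed
  show ?thesis using lo hi len by (simp add: shape_strip_iff_nth)
qed

lemma growth_square_local_rule:
  assumes "shape_strip m \<alpha> \<beta>" "shape_strip m \<alpha> \<gamma>"
  shows "growth_square m \<alpha> \<beta> \<gamma> (local_rule \<alpha> \<beta> \<gamma>)"
  using assms shape_strip_local_rule[OF assms] shape_strip_local_rule[OF assms(2,1)]
  by (simp add: growth_square_def local_rule_commute)

text \<open>
  Read from the top row downwards, the equation \<open>local_rule \<alpha> \<beta> \<gamma> = \<delta>\<close> determines first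
  \<open>\<alpha> ! i - carry \<alpha> \<beta> \<gamma> i\<close> and then both terms of this difference.
\<close>

lemma local_rule_inject:
  assumes eq: "local_rule \<alpha> \<beta> \<gamma> = local_rule \<alpha>' \<beta> \<gamma>"
  shows "\<alpha> = \<alpha>'"
proof -
  let ?c = "carry \<alpha> \<beta> \<gamma>" and ?c' = "carry \<alpha>' \<beta> \<gamma>" and ?m = "length \<alpha>"
  have len: "length \<alpha>' = ?m" using arg_cong[OF eq, of length] by simp
  have eqs: "local_rule \<alpha> \<beta> \<gamma> ! i = local_rule \<alpha>' \<beta> \<gamma> ! i" for i by (simp add: eq)
  have step: "\<alpha> ! i = \<alpha>' ! i \<and> ?c i = ?c' i"
    if "Suc i < ?m" "\<alpha> ! i - ?c i = \<alpha>' ! i - ?c' i" for i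
    using eqs[of "Suc i"] that len
    by (simp add: nth_local_rule_Suc carry_step[of i \<alpha>] carry_step[of i \<alpha>'])
      (auto simp: min_def max_def split: if_splits)
  have diff: "i < ?m \<Longrightarrow> \<alpha> ! i - ?c i = \<alpha>' ! i - ?c' i" for i
  proof (induction i)
    case 0
    then show ?case using eqs[of 0] len
      by (simp add: nth_local_rule_0[of \<alpha>] nth_local_rule_0[of \<alpha>'])
  next
    case (Suc i)
    then have "\<alpha> ! i = \<alpha>' ! i \<and> ?c i = ?c' i" using step by simp
    then show ?case
      using eqs[of "Suc i"] Suc.prems len
      by (simp add: nth_local_rule_Suc carry_step[of i \<alpha>] carry_step[of i \<alpha>'])
        (auto simp: min_def max_def split: if_splits)
  qed
  show ?thesis
  proof (rule nth_equalityI)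
    fix i assume i: "i < ?m"
    show "\<alpha> ! i = \<alpha>' ! i"
    proof (cases "Suc i < ?m")
      case True
      then show ?thesis using step diff i by blast
    next
      case False
      then show ?thesis using diff[OF i] len by (simp add: carry_bottom)
    qed
  qed (simp add: len)
qed

text \<open>The carries as read from the top. For the \<open>\<alpha>\<close> constructed below and
  \<open>Suc i < m\<close>, the value at \<open>Suc i\<close> is
  \<open>carry \<alpha> \<beta> \<gamma> i\<close>, the amount leaving row \<open>Suc i\<close>
  upwards; nothing leaves row 0. The bracket subtracted from \<open>\<delta> ! Suc i\<close> is
  \<open>\<alpha> ! i - carry \<alpha> \<beta> \<gamma> i\<close>.\<close>

primrec down_carry :: "shape \<Rightarrow> shape \<Rightarrow> shape \<Rightarrow> nat \<Rightarrow> int" where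
  "down_carry \<beta> \<gamma> \<delta> 0 = 0"
| "down_carry \<beta> \<gamma> \<delta> (Suc i) = max (\<delta> ! Suc i - (\<beta> ! i + \<gamma> ! i - \<delta> ! i - down_carry \<beta> \<gamma> \<delta> i)) 0"

lemma down_carry_nonneg: "0 \<le> down_carry \<beta> \<gamma> \<delta> i"
  by (cases i) auto

lemma growth_square_exists:
  assumes "shape_strip m \<beta> \<delta>" "shape_strip m \<gamma> \<delta>"
  shows "\<exists>\<alpha>. growth_square m \<alpha> \<beta> \<gamma> \<delta>"
proof -
  define d where "d = down_carry \<beta> \<gamma> \<delta>"
  define y where "y i = \<beta> ! i + \<gamma> ! i - \<delta> ! i - d i" for i
  \<comment> \<open>If row \<open>i\<close> receives a positive carry, row \<open>Suc i\<close> of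
    \<open>\<delta>\<close> was capped at \<open>\<alpha> ! i\<close>; otherwise
    \<open>\<alpha> ! i = y i\<close>, and \<open>\<delta> ! Suc i\<close> does not exceed it. The
    maximum covers both cases, and the bottom row receives no carry.\<close>
  define \<alpha> where "\<alpha> = map (\<lambda>i. if Suc i < m then max (y i) (\<delta> ! Suc i) else y i) [0..<m]"
  have d_Suc: "d (Suc i) = max (\<delta> ! Suc i - y i) 0" for i by (simp add: d_def y_def)
  have d_0: "d 0 = 0" by (simp add: d_def)
  have d_nonneg: "0 \<le> d i" for i by (simp add: d_def down_carry_nonneg)
  have len: "length \<alpha> = m" "length \<beta> = m" "length \<gamma> = m" "length \<delta> = m"
    using assms by (auto simp: shape_strip_iff_nth \<alpha>_def)
  have \<alpha>_upper: "\<alpha> ! i = max (y i) (\<delta> ! Suc i)" if "Suc i < m" for i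
    using that by (simp add: \<alpha>_def)
  have \<alpha>_bottom: "\<alpha> ! i = y i" if "i < m" "\<not> Suc i < m" for i
    using that by (simp add: \<alpha>_def)
  have y_eq: "\<beta> ! i + \<gamma> ! i - y i = \<delta> ! i + d i" for i
    by (simp add: y_def)
  \<comment> \<open>The true carries come from below, hence induction from the bottom row, although
    \<open>y\<close> was computed from the top.\<close>
  have c_eq: "i < m \<Longrightarrow> \<alpha> ! i - carry \<alpha> \<beta> \<gamma> i = y i" for i
  proof (induction "m - i" arbitrary: i)
    case 0
    then show ?case by simp
  next
    case (Suc n)
    show ?case
    proof (cases "Suc i < m")
      case True
      with Suc have "\<alpha> ! Suc i - carry \<alpha> \<beta> \<gamma> (Suc i) = y (Suc i)" by simp
      then show ?thesis
        using True len y_eq[of "Suc i"] d_Suc[of i] \<alpha>_upper[of i]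
        by (simp add: carry_step max_def split: if_splits)
    next
      case False
      with Suc show ?thesis by (simp add: carry_bottom len \<alpha>_bottom)
    qed
  qed
  have "local_rule \<alpha> \<beta> \<gamma> = \<delta>"
  proof (rule nth_equalityI)
    fix i assume "i < length (local_rule \<alpha> \<beta> \<gamma>)"
    then have i: "i < m" by (simp add: len)
    show "local_rule \<alpha> \<beta> \<gamma> ! i = \<delta> ! i"
    proof (cases i)
      case 0
      then show ?thesis using i len c_eq[of 0] y_eq[of 0] d_0 by (simp add: nth_local_rule_0)
    next
      case (Suc k)
      then show ?thesis
        using i len c_eq[of i] y_eq[of i] \<alpha>_upper[of k] d_Suc[of k]
        by (simp add: nth_local_rule_Suc)
    qed
  qed (simp add: len)
  moreover have below: "\<alpha> ! i \<le> \<beta> ! i \<and> \<alpha> ! i \<le> \<gamma> ! i" if "i < m" for i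
  proof -
    have "y i \<le> \<beta> ! i" "y i \<le> \<gamma> ! i"
      using that assms d_nonneg[of i] y_eq[of i] by (auto simp: shape_strip_iff_nth)
    then show ?thesis
      using that assms by (cases "Suc i < m") (auto simp: \<alpha>_upper \<alpha>_bottom shape_strip_iff_nth)
  qed
  moreover have "\<beta> ! Suc i \<le> \<alpha> ! i \<and> \<gamma> ! Suc i \<le> \<alpha> ! i" if "Suc i < m" for i
    using that assms by (auto simp: \<alpha>_upper shape_strip_iff_nth intro: max.coboundedI2)
  ultimately show ?thesis
    using assms len by (auto simp: growth_square_def shape_strip_iff_nth)
qed

lemma reverse_local_rule_eq:
  assumes "growth_square m \<alpha> \<beta> \<gamma> \<delta>"
  shows "reverse_local_rule \<beta> \<gamma> \<delta> = \<alpha>"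
  unfolding reverse_local_rule_def
proof (rule the_equality)
  have "length \<delta> = m" using assms by (auto simp: growth_square_def shape_strip_iff_nth)
  then show "is_shape (length \<delta>) \<alpha> \<and> horizontal_strip \<alpha> \<beta> \<and> horizontal_strip \<alpha> \<gamma> \<and>
      local_rule \<alpha> \<beta> \<gamma> = \<delta>"
    using assms by (auto simp: growth_square_def shape_strip_def)
next
  fix \<alpha>'
  assume "is_shape (length \<delta>) \<alpha>' \<and> horizontal_strip \<alpha>' \<beta> \<and> horizontal_strip \<alpha>' \<gamma> \<and>
      local_rule \<alpha>' \<beta> \<gamma> = \<delta>"
  then show "\<alpha>' = \<alpha>"
    using assms by (auto simp: growth_square_def intro: local_rule_inject)
qed

lemma growth_square_reverse_local_rule:
  assumes "shape_strip m \<beta> \<delta>" "shape_strip m \<gamma> \<delta>"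
  shows "growth_square m (reverse_local_rule \<beta> \<gamma> \<delta>) \<beta> \<gamma> \<delta>"
  using growth_square_exists[OF assms] reverse_local_rule_eq by blast


section \<open>Growth diagrams\<close>

lemma is_tableau_iff_nth:
  "is_tableau m P \<longleftrightarrow> P \<noteq> [] \<and> is_shape m (P ! 0) \<and>
     (\<forall>j. Suc j < length P \<longrightarrow> shape_strip m (P ! j) (P ! Suc j))"
proof
  assume "is_tableau m P"
  then show "P \<noteq> [] \<and> is_shape m (P ! 0) \<and>
      (\<forall>j. Suc j < length P \<longrightarrow> shape_strip m (P ! j) (P ! Suc j))"
    by (auto simp: is_tableau_def shape_strip_def successively_conv_nth)
next
  assume *: "P \<noteq> [] \<and> is_shape m (P ! 0) \<and>
      (\<forall>j. Suc j < length P \<longrightarrow> shape_strip m (P ! j) (P ! Suc j))"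
  have "is_shape m (P ! j)" if "j < length P" for j
    using that * by (cases j) (auto simp: shape_strip_def)
  with * show "is_tableau m P"
    by (auto simp: is_tableau_def shape_strip_def successively_conv_nth in_set_conv_nth)
qed

lemma is_tableau_nth_shape: "is_tableau m P \<Longrightarrow> j < length P \<Longrightarrow> is_shape m (P ! j)"
  by (auto simp: is_tableau_def)

lemma is_tableau_nth_strip:
  "is_tableau m P \<Longrightarrow> Suc j < length P \<Longrightarrow> shape_strip m (P ! j) (P ! Suc j)"
  by (auto simp: is_tableau_iff_nth)

text \<open>\<open>R\<close> and \<open>S\<close> stay abstract because both procedures use the
  lemma: with \<open>shape_strip\<close> and \<open>growth_square\<close> for filling forwards, and
  with the arguments of both reversed for the array rotated by a half-turn.\<close>

lemma fill_square:
  assumes step: "\<And>a b c. R a b \<Longrightarrow> R a c \<Longrightarrow> S a b c (r a b c)"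
    and out: "\<And>a b c d. S a b c d \<Longrightarrow> R b d \<and> R c d"
    and P: "\<And>j. Suc j < length P \<Longrightarrow> R (P ! j) (P ! Suc j)"
    and Q: "\<And>i. Suc i < length Q \<Longrightarrow> R (Q ! i) (Q ! Suc i)"
    and corner: "P ! 0 = Q ! 0"
    and "Suc i < length Q" "Suc j < length P"
  shows "S (fill r P Q i j) (fill r P Q i (Suc j)) (fill r P Q (Suc i) j) (fill r P Q (Suc i) (Suc j))"
proof -
  let ?f = "fill r P Q"
  have col: "?f i 0 = Q ! i" for i by (cases i) (simp_all add: corner)
  have square: "S (?f i j) (?f i (Suc j)) (?f (Suc i) j) (?f (Suc i) (Suc j))"
    if "R (?f i j) (?f i (Suc j))" "R (?f i j) (?f (Suc i) j)" for i j
    using step[OF that] by simp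
  have vert: "R (?f i j) (?f (Suc i) j)"
    if H: "\<And>j. Suc j < length P \<Longrightarrow> R (?f i j) (?f i (Suc j))"
      and i: "Suc i < length Q" and "j < length P" for i j
    using \<open>j < length P\<close>
  proof (induction j)
    case 0
    then show ?case using Q[OF i] by (simp add: col del: fill.simps)
  next
    case (Suc j)
    then show ?case using out[OF square[OF H[of j]]] by (simp del: fill.simps)
  qed
  have horiz: "R (?f i j) (?f i (Suc j))" if "i < length Q" "Suc j < length P" for i j
    using that
  proof (induction i arbitrary: j)
    case 0
    then show ?case using P by simp
  next
    case (Suc i)
    have "R (?f i j) (?f i (Suc j))" "R (?f i j) (?f (Suc i) j)"
      using Suc vert[of i j] by (simp_all del: fill.simps)
    then show ?case using out[OF square] by (simp del: fill.simps)
  qed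
  show ?thesis
    using assms(6,7) by (intro square horiz vert) simp_all
qed

text \<open>To evaluate an insertion it is therefore enough to know some array with the right
  borders that obeys the rule.\<close>

lemma fill_unique:
  assumes G: "\<And>i j. Suc i < length Q \<Longrightarrow> Suc j < length P \<Longrightarrow>
      G (Suc i) (Suc j) = r (G i j) (G i (Suc j)) (G (Suc i) j)"
    and P: "\<And>j. j < length P \<Longrightarrow> P ! j = G 0 j"
    and Q: "\<And>i. i < length Q \<Longrightarrow> Q ! i = G i 0"
  shows "i < length Q \<Longrightarrow> j < length P \<Longrightarrow> fill r P Q i j = G i j"
  using assms by (induction r P Q i j rule: fill.induct) auto

text \<open>\<open>p\<close> and \<open>q\<close> count steps, so there is one more column and one
  more row. Strips are listed besides squares because an array with a single row or column contains
  no square.\<close>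

definition growth :: "nat \<Rightarrow> nat \<Rightarrow> nat \<Rightarrow> (nat \<Rightarrow> nat \<Rightarrow> shape) \<Rightarrow> bool" where
  "growth m p q G \<longleftrightarrow> is_shape m (G 0 0) \<and>
     (\<forall>i\<le>q. \<forall>j<p. shape_strip m (G i j) (G i (Suc j))) \<and>
     (\<forall>i<q. \<forall>j\<le>p. shape_strip m (G i j) (G (Suc i) j)) \<and>
     (\<forall>i<q. \<forall>j<p. growth_square m (G i j) (G i (Suc j)) (G (Suc i) j) (G (Suc i) (Suc j)))"

definition growth_row :: "(nat \<Rightarrow> nat \<Rightarrow> shape) \<Rightarrow> nat \<Rightarrow> nat \<Rightarrow> tableau" where
  "growth_row G p i = map (G i) [0..<Suc p]"

definition growth_col :: "(nat \<Rightarrow> nat \<Rightarrow> shape) \<Rightarrow> nat \<Rightarrow> nat \<Rightarrow> tableau" where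
  "growth_col G q j = map (\<lambda>i. G i j) [0..<Suc q]"

lemma growth_row_simps [simp]:
  "length (growth_row G p i) = Suc p" "j \<le> p \<Longrightarrow> growth_row G p i ! j = G i j"
  "hd (growth_row G p i) = G i 0" "last (growth_row G p i) = G i p" "growth_row G p i \<noteq> []"
  by (auto simp: growth_row_def hd_map last_map nth_append simp del: upt_Suc)

lemma growth_col_simps [simp]:
  "length (growth_col G q j) = Suc q" "i \<le> q \<Longrightarrow> growth_col G q j ! i = G i j"
  "hd (growth_col G q j) = G 0 j" "last (growth_col G q j) = G q j" "growth_col G q j \<noteq> []"
  by (auto simp: growth_col_def hd_map last_map nth_append simp del: upt_Suc)

lemma growth_shape:
  assumes "growth m p q G" "i \<le> q" "j \<le> p"
  shows "is_shape m (G i j)"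
proof (cases i)
  case 0
  then show ?thesis using assms
    by (cases j) (auto simp: growth_def shape_strip_def)
next
  case (Suc k)
  then have "shape_strip m (G k j) (G (Suc k) j)" using assms by (simp add: growth_def)
  then show ?thesis using Suc by (simp add: shape_strip_def)
qed

lemma growth_row_tableau: "growth m p q G \<Longrightarrow> i \<le> q \<Longrightarrow> is_tableau m (growth_row G p i)"
  by (auto simp: is_tableau_iff_nth growth_shape) (auto simp: growth_def)

lemma growth_col_tableau: "growth m p q G \<Longrightarrow> j \<le> p \<Longrightarrow> is_tableau m (growth_col G q j)"
  by (auto simp: is_tableau_iff_nth growth_shape) (auto simp: growth_def)

lemma growth_transpose: "growth m p q G \<Longrightarrow> growth m q p (\<lambda>i j. G j i)"
  by (auto simp: growth_def growth_square_commute)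

lemma column_insert_growth:
  assumes "growth m p q G"
  shows "column_insert (growth_row G p 0, growth_col G q 0) = (growth_row G p q, growth_col G q p)"
proof -
  have "fill local_rule (growth_row G p 0) (growth_col G q 0) i j = G i j"
    if "i \<le> q" "j \<le> p" for i j
    using that assms
    by (intro fill_unique) (auto simp: growth_def growth_square_def)
  then show ?thesis
    unfolding column_insert_def last_row_def last_col_def
    by (auto simp: growth_row_def growth_col_def simp del: upt_Suc)
qed

lemma rev_growth_row: "rev (growth_row G p i) = map (\<lambda>j. G i (p - j)) [0..<Suc p]"
  by (rule nth_equalityI) (auto simp: rev_nth simp del: upt_Suc)

lemma rev_growth_col: "rev (growth_col G q j) = map (\<lambda>i. G (q - i) j) [0..<Suc q]"
  by (rule nth_equalityI) (auto simp: rev_nth simp del: upt_Suc)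

lemma reverse_column_insert_growth:
  assumes "growth m p q G"
  shows "reverse_column_insert (growth_row G p q, growth_col G q p) =
    (growth_row G p 0, growth_col G q 0)"
proof -
  let ?r = "\<lambda>\<delta> \<gamma> \<beta>. reverse_local_rule \<beta> \<gamma> \<delta>"
  let ?f = "fill ?r (rev (growth_row G p q)) (rev (growth_col G q p))"
  have rule: "?r (G (q - i) (p - j)) (G (q - i) (p - Suc j)) (G (q - Suc i) (p - j)) =
      G (q - Suc i) (p - Suc j)" if "i < q" "j < p" for i j
  proof -
    have "growth_square m (G (q - Suc i) (p - Suc j)) (G (q - Suc i) (Suc (p - Suc j)))
        (G (Suc (q - Suc i)) (p - Suc j)) (G (Suc (q - Suc i)) (Suc (p - Suc j)))"
      using assms that by (simp add: growth_def)
    then show ?thesis using reverse_local_rule_eq that by (simp add: Suc_diff_Suc)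
  qed
  have "?f i j = G (q - i) (p - j)" if "i \<le> q" "j \<le> p" for i j
    using that
    by (intro fill_unique[where G = "\<lambda>i j. G (q - i) (p - j)"])
      (auto simp: rule rev_nth)
  then have "last_row ?r (rev (growth_row G p q)) (rev (growth_col G q p)) = rev (growth_row G p 0)"
    "last_col ?r (rev (growth_row G p q)) (rev (growth_col G q p)) = rev (growth_col G q 0)"
    by (auto simp: last_row_def last_col_def rev_growth_row rev_growth_col simp del: upt_Suc)
  then show ?thesis by (simp add: reverse_column_insert_def)
qed

lemma inner_pair_growth:
  assumes "(P, Q) \<in> inner_pairs m"
  obtains G where "growth m (length P - 1) (length Q - 1) G"
    "P = growth_row G (length P - 1) 0" "Q = growth_col G (length Q - 1) 0"
proof -
  define f where "f = fill local_rule P Q"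
  have tab: "is_tableau m P" "is_tableau m Q" and nonempty: "P \<noteq> []" "Q \<noteq> []"
    and corner: "P ! 0 = Q ! 0"
    using assms by (auto simp: inner_pairs_def is_tableau_def hd_conv_nth)
  have row: "f 0 j = P ! j" and col: "f i 0 = Q ! i" for i j
    unfolding f_def using corner by (cases i; simp)+
  have square: "growth_square m (f i j) (f i (Suc j)) (f (Suc i) j) (f (Suc i) (Suc j))"
    if "Suc i < length Q" "Suc j < length P" for i j
    unfolding f_def
    by (rule fill_square[where R = "shape_strip m"])
      (use that corner tab in \<open>auto simp: is_tableau_nth_strip simp del: fill.simps
          intro: growth_square_local_rule dest: growth_squareD\<close>)
  have "shape_strip m (f i j) (f i (Suc j))" if "i < length Q" "Suc j < length P" for i j
    using that square[of "i - 1" j] tab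
    by (cases i) (auto simp: row is_tableau_nth_strip growth_square_def)
  moreover have "shape_strip m (f i j) (f (Suc i) j)" if "Suc i < length Q" "j < length P" for i j
    using that square[of i "j - 1"] tab
    by (cases j) (auto simp: col is_tableau_nth_strip growth_square_def)
  moreover have "is_shape m (f 0 0)" using tab nonempty by (simp add: row is_tableau_nth_shape)
  ultimately have "growth m (length P - 1) (length Q - 1) f"
    using square nonempty unfolding growth_def
    by (metis Suc_diff_1 Suc_less_eq le_imp_less_Suc length_greater_0_conv)
  moreover have "P = growth_row f (length P - 1) 0"
    using nonempty by (intro nth_equalityI) (auto simp: row)
  moreover have "Q = growth_col f (length Q - 1) 0"
    using nonempty by (intro nth_equalityI) (auto simp: col)
  ultimately show ?thesis using that by blast
qed

lemma outer_pair_growth: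
  assumes "(T, U) \<in> outer_pairs m"
  obtains G where "growth m (length T - 1) (length U - 1) G"
    "T = growth_row G (length T - 1) (length U - 1)"
    "U = growth_col G (length U - 1) (length T - 1)"
proof -
  define r where "r = (\<lambda>\<delta> \<gamma> \<beta>. reverse_local_rule \<beta> \<gamma> \<delta>)"
  define f where "f = fill r (rev T) (rev U)"
  define p q where "p = length T - 1" and "q = length U - 1"
  \<comment> \<open>Undoes the half-turn, so that indices start at the upper left corner
    again.\<close>
  define G where "G i j = f (q - i) (p - j)" for i j
  have tab: "is_tableau m T" "is_tableau m U" and nonempty: "T \<noteq> []" "U \<noteq> []"
    and corner: "rev T ! 0 = rev U ! 0"
    using assms by (auto simp: outer_pairs_def is_tableau_def rev_nth last_conv_nth)
  have len: "length T = Suc p" "length U = Suc q" using nonempty by (auto simp: p_def q_def)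
  have "f 0 j = rev T ! j" "f i 0 = rev U ! i" for i j
    unfolding f_def using corner by (cases i; simp)+
  then have row: "\<And>j. j \<le> p \<Longrightarrow> G q j = T ! j" and col: "\<And>i. i \<le> q \<Longrightarrow> G i p = U ! i"
    using len by (auto simp: G_def rev_nth)
  have tab': "shape_strip m (rev T ! Suc j) (rev T ! j)" if "Suc j < length T" for j
    using is_tableau_nth_strip[OF tab(1), of "p - Suc j"] that len
    by (simp add: rev_nth Suc_diff_Suc)
  have tab'': "shape_strip m (rev U ! Suc j) (rev U ! j)" if "Suc j < length U" for j
    using is_tableau_nth_strip[OF tab(2), of "q - Suc j"] that len
    by (simp add: rev_nth Suc_diff_Suc)
  have f_square: "growth_square m (f (Suc i) (Suc j)) (f (Suc i) j) (f i (Suc j)) (f i j)"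
    if "Suc i < length U" "Suc j < length T" for i j
    unfolding f_def
    by (rule fill_square[where R = "\<lambda>a b. shape_strip m b a"
          and S = "\<lambda>\<delta> \<gamma> \<beta> \<alpha>. growth_square m \<alpha> \<beta> \<gamma> \<delta>"])
      (use that corner tab' tab'' in \<open>auto simp: r_def simp del: fill.simps
          intro: growth_square_reverse_local_rule dest: growth_squareD\<close>)
  have square: "growth_square m (G i j) (G i (Suc j)) (G (Suc i) j) (G (Suc i) (Suc j))"
    if "i < q" "j < p" for i j
    using f_square[of "q - Suc i" "p - Suc j"] that len by (simp add: G_def Suc_diff_Suc)
  have "shape_strip m (G i j) (G i (Suc j))" if "i \<le> q" "j < p" for i j
    using that square[of i j] tab len
    by (cases "i = q") (auto simp: row is_tableau_nth_strip growth_square_def)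
  moreover have "shape_strip m (G i j) (G (Suc i) j)" if "i < q" "j \<le> p" for i j
    using that square[of i j] tab len
    by (cases "j = p") (auto simp: col is_tableau_nth_strip growth_square_def)
  ultimately have "growth m p q G"
    using square tab nonempty row[of 0] col[of 0] unfolding growth_def
    by (cases p; cases q) (auto simp: shape_strip_def is_tableau_nth_shape)
  moreover have "T = growth_row G p q" "U = growth_col G q p"
    using row col len by (auto intro!: nth_equalityI)
  ultimately show ?thesis using that unfolding p_def q_def by blast
qed

lemma growth_inner_pair:
  "growth m p q G \<Longrightarrow> (growth_row G p 0, growth_col G q 0) \<in> inner_pairs m"
  by (simp add: inner_pairs_def growth_row_tableau growth_col_tableau)

lemma growth_outer_pair:
  "growth m p q G \<Longrightarrow> (growth_row G p q, growth_col G q p) \<in> outer_pairs m"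
  by (simp add: outer_pairs_def growth_row_tableau growth_col_tableau)

lemma reverse_column_insert_column_insert:
  assumes "x \<in> inner_pairs m"
  shows "column_insert x \<in> outer_pairs m" "reverse_column_insert (column_insert x) = x"
proof -
  obtain P Q where x: "x = (P, Q)" by fastforce
  then obtain G where "growth m (length P - 1) (length Q - 1) G"
    "P = growth_row G (length P - 1) 0" "Q = growth_col G (length Q - 1) 0"
    using assms inner_pair_growth by blast
  then show "column_insert x \<in> outer_pairs m" "reverse_column_insert (column_insert x) = x"
    unfolding x
    by (metis column_insert_growth growth_outer_pair,
        metis column_insert_growth reverse_column_insert_growth)
qed

lemma column_insert_reverse_column_insert:
  assumes "y \<in> outer_pairs m"
  shows "reverse_column_insert y \<in> inner_pairs m" "column_insert (reverse_column_insert y) = y"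
proof -
  obtain T U where y: "y = (T, U)" by fastforce
  then obtain G where "growth m (length T - 1) (length U - 1) G"
    "T = growth_row G (length T - 1) (length U - 1)"
    "U = growth_col G (length U - 1) (length T - 1)"
    using assms outer_pair_growth by blast
  then show "reverse_column_insert y \<in> inner_pairs m" "column_insert (reverse_column_insert y) = y"
    unfolding y
    by (metis reverse_column_insert_growth growth_inner_pair,
        metis column_insert_growth reverse_column_insert_growth)
qed

lemma bij_betw_column_insert: "bij_betw column_insert (inner_pairs m) (outer_pairs m)"
  by (rule bij_betw_byWitness[where f' = reverse_column_insert])
    (auto simp: reverse_column_insert_column_insert column_insert_reverse_column_insert)


section \<open>Moving single boxes\<close>

definition shift_row :: "int \<Rightarrow> nat \<Rightarrow> shape \<Rightarrow> shape" where
  "shift_row d r s = s[r := s ! r + d]"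

lemma length_shift_row [simp]: "length (shift_row d r s) = length s"
  by (simp add: shift_row_def)

lemma nth_shift_row:
  "i < length s \<Longrightarrow> shift_row d r s ! i = (if i = r then s ! i + d else s ! i)"
  by (simp add: shift_row_def nth_list_update)

text \<open>
  \<open>bump \<alpha> \<beta> r r'\<close>: internal insertion of a box in row \<open>r\<close> into the strip \<open>\<beta>/\<alpha>\<close> adds a box to
  \<open>\<beta>\<close> in row \<open>r'\<close>. \<open>descend m \<alpha> \<beta> r r'\<close>: a slide through the strip \<open>\<beta>/\<alpha>\<close> that starts in
  row \<open>r\<close> ends in row \<open>r'\<close>.
\<close>

definition bump :: "shape \<Rightarrow> shape \<Rightarrow> nat \<Rightarrow> nat \<Rightarrow> bool" where
  "bump \<alpha> \<beta> r r' \<longleftrightarrow> r' \<le> r \<and> (\<forall>i. r' \<le> i \<and> i < r \<longrightarrow> \<beta> ! Suc i = \<alpha> ! i) \<and>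
     (\<forall>i. r' = Suc i \<longrightarrow> \<beta> ! Suc i < \<alpha> ! i)"

definition descend :: "nat \<Rightarrow> shape \<Rightarrow> shape \<Rightarrow> nat \<Rightarrow> nat \<Rightarrow> bool" where
  "descend m \<alpha> \<beta> r r' \<longleftrightarrow> r' = (if Suc r < m \<and> \<beta> ! Suc r = \<alpha> ! r then Suc r else r)"

lemma bump_exists:
  assumes "\<And>i. i < r \<Longrightarrow> \<beta> ! Suc i \<le> \<alpha> ! i"
  shows "\<exists>r'. bump \<alpha> \<beta> r r'"
  using assms
proof (induction r)
  case 0
  show ?case by (auto simp: bump_def)
next
  case (Suc r)
  show ?case
  proof (cases "\<beta> ! Suc r = \<alpha> ! r")
    case True
    obtain r' where "bump \<alpha> \<beta> r r'" using Suc by auto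
    then have "bump \<alpha> \<beta> (Suc r) r'" using True by (auto simp: bump_def less_Suc_eq)
    then show ?thesis ..
  next
    case False
    then have "\<beta> ! Suc r < \<alpha> ! r" using Suc.prems[of r] by simp
    then have "bump \<alpha> \<beta> (Suc r) (Suc r)" by (auto simp: bump_def)
    then show ?thesis ..
  qed
qed

text \<open>Splits off the topmost box of an inserted strip: inserting \<open>\<gamma>\<close> with
  an extra box in row \<open>r\<close> amounts to inserting \<open>\<gamma>\<close> and then the box
  into the resulting strip. The box raises the carry by one exactly in the rows from
  \<open>r'\<close> to \<open>r - 1\<close>, since the rows below \<open>r'\<close> down to
  \<open>r\<close> are at their cap while row \<open>r'\<close> has room or is the top row. The
  second conclusion is the hypothesis on the upper rows for the next strip.\<close>

lemma local_rule_bump: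
  assumes strips: "shape_strip m \<alpha> \<beta>" "shape_strip m \<alpha> \<gamma>"
    and r: "r < m" "\<And>i. i < r \<Longrightarrow> \<gamma> ! i = \<alpha> ! i"
    and bump: "bump \<gamma> (local_rule \<alpha> \<beta> \<gamma>) r r'"
  shows "local_rule \<alpha> \<beta> (shift_row 1 r \<gamma>) = shift_row 1 r' (local_rule \<alpha> \<beta> \<gamma>)"
    and "\<And>i. i < r' \<Longrightarrow> local_rule \<alpha> \<beta> \<gamma> ! i = \<beta> ! i"
proof -
  define c where "c = carry \<alpha> \<beta> (shift_row 1 r \<gamma>)"
  define c' where "c' = carry \<alpha> \<beta> \<gamma>"
  have len: "length \<alpha> = m" "length \<beta> = m" "length \<gamma> = m"
    using strips by (auto simp: shape_strip_iff_nth)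
  have r': "r' \<le> r" using bump by (simp add: bump_def)
  have \<gamma>: "shift_row 1 r \<gamma> ! i = (if i = r then \<gamma> ! i + 1 else \<gamma> ! i)" if "i < m" for i
    using that by (simp add: nth_shift_row len)
  have c_step: "c i = max (\<beta> ! Suc i + shift_row 1 r \<gamma> ! Suc i + c (Suc i) - \<alpha> ! Suc i - \<alpha> ! i) 0"
    "c' i = max (\<beta> ! Suc i + \<gamma> ! Suc i + c' (Suc i) - \<alpha> ! Suc i - \<alpha> ! i) 0" if "Suc i < m" for i
    using that by (simp_all add: c_def c'_def carry_step len)
  have \<delta>: "local_rule \<alpha> \<beta> \<gamma> ! Suc i = min (\<beta> ! Suc i + \<gamma> ! Suc i + c' (Suc i) - \<alpha> ! Suc i) (\<alpha> ! i)"
    if "Suc i < m" for i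
    using that by (simp add: nth_local_rule_Suc c'_def len)
  \<comment> \<open>Where the box is bumped on, row \<open>Suc i\<close> of \<open>\<delta>\<close>
    equals \<open>\<gamma> ! i = \<alpha> ! i\<close>: the minimum is the cap, and an additional
    unit goes entirely into the carry.\<close>
  have blocked: "\<alpha> ! i \<le> \<beta> ! Suc i + \<gamma> ! Suc i + c' (Suc i) - \<alpha> ! Suc i" if "r' \<le> i" "i < r" for i
  proof -
    have "local_rule \<alpha> \<beta> \<gamma> ! Suc i = \<alpha> ! i" using bump that r(2) by (simp add: bump_def)
    then show ?thesis using \<delta>[of i] that r(1) by simp
  qed
  have free: "\<beta> ! Suc i + \<gamma> ! Suc i + c' (Suc i) - \<alpha> ! Suc i < \<alpha> ! i" if "r' = Suc i" for i
  proof -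
    have "local_rule \<alpha> \<beta> \<gamma> ! Suc i < \<alpha> ! i" using bump that r(2) r' by (simp add: bump_def)
    then show ?thesis using \<delta>[of i] that r(1) r' by (simp add: min_def split: if_splits)
  qed
  have below: "c i = c' i" if "r \<le> i" for i
    using that
  proof (induction "m - i" arbitrary: i)
    case 0
    then show ?case by (simp add: c_def c'_def carry_bottom len)
  next
    case (Suc n)
    then show ?case
      by (cases "Suc i < m") (simp_all add: c_step[of i] \<gamma>, simp add: c_def c'_def carry_bottom len)
  qed
  have between: "c i = c' i + 1" if "r' \<le> i" "i < r" for i
    using that
  proof (induction "r - i" arbitrary: i)
    case (Suc n)
    have "c (Suc i) = c' (Suc i) + (if Suc i = r then 0 else 1)"
      using Suc below[of "Suc i"] by auto
    then show ?case
      using Suc.prems r(1) blocked[of i] by (cases "Suc i = r") (auto simp: c_step[of i] \<gamma>)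
  qed simp
  \<comment> \<open>The room in row \<open>r'\<close> absorbs the extra unit; higher up
    \<open>\<gamma>\<close> agrees with \<open>\<alpha>\<close>, and the strip
    \<open>\<beta>/\<alpha>\<close> alone produces no carry.\<close>
  have above: "c i = 0 \<and> c' i = 0" if "i < r'" for i
    using that
  proof (induction "r' - i" arbitrary: i)
    case (Suc n)
    show ?case
    proof (cases "Suc i = r'")
      case True
      have "c (Suc i) = c' (Suc i) + (if Suc i = r then 0 else 1)"
        using True below[of "Suc i"] between[of "Suc i"] r' by auto
      then show ?thesis
        using free[of i] True r(1) r' by (cases "r' = r") (auto simp: c_step[of i] \<gamma>)
    next
      case False
      then have "c (Suc i) = 0 \<and> c' (Suc i) = 0" using Suc by simp
      moreover have "\<beta> ! Suc i \<le> \<alpha> ! i"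
        using strips(1) Suc.prems r' r(1) by (simp add: shape_strip_iff_nth)
      ultimately show ?thesis
        using False Suc.prems r r' by (simp add: c_step[of i] \<gamma>)
    qed
  qed simp
  show top: "local_rule \<alpha> \<beta> \<gamma> ! i = \<beta> ! i" if "i < r'" for i
  proof (cases i)
    case 0
    then show ?thesis using that r r' above[of 0] len by (simp add: nth_local_rule_0 c'_def)
  next
    case (Suc k)
    moreover have "\<beta> ! Suc k \<le> \<alpha> ! k"
      using strips(1) that Suc r' r(1) by (simp add: shape_strip_iff_nth)
    ultimately show ?thesis using that r r' above[of i] by (simp add: \<delta>)
  qed
  show "local_rule \<alpha> \<beta> (shift_row 1 r \<gamma>) = shift_row 1 r' (local_rule \<alpha> \<beta> \<gamma>)"
  proof (rule nth_equalityI)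
    fix i assume "i < length (local_rule \<alpha> \<beta> (shift_row 1 r \<gamma>))"
    then have i: "i < m" by (simp add: len)
    have c_eq: "c i = c' i + (if r' \<le> i \<and> i < r then 1 else 0)"
      using below[of i] between[of i] above[of i] r' by (auto simp: not_le not_less)
    show "local_rule \<alpha> \<beta> (shift_row 1 r \<gamma>) ! i = shift_row 1 r' (local_rule \<alpha> \<beta> \<gamma>) ! i"
    proof (cases i)
      case 0
      then show ?thesis using i c_eq r'
        by (simp add: nth_local_rule_0 nth_shift_row len flip: c_def c'_def)
    next
      case (Suc k)
      then show ?thesis using i c_eq r' blocked[of k] free[of k]
        by (auto simp: nth_local_rule_Suc nth_shift_row len simp flip: c_def c'_def)
    qed
  qed (simp add: len)
qed

lemma local_rule_trivial:
  assumes "shape_strip m \<alpha> \<beta>"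
  shows "local_rule \<alpha> \<beta> \<alpha> = \<beta>"
proof -
  have len: "length \<alpha> = m" "length \<beta> = m"
    and strip: "\<And>i. Suc i < m \<Longrightarrow> \<beta> ! Suc i \<le> \<alpha> ! i"
    using assms by (auto simp: shape_strip_iff_nth)
  have c: "carry \<alpha> \<beta> \<alpha> i = 0" for i
  proof (induction "m - i" arbitrary: i)
    case 0
    then show ?case by (simp add: carry_bottom len)
  next
    case (Suc n)
    then show ?case
      by (cases "Suc i < m") (simp_all add: carry_step strip len carry_bottom)
  qed
  show ?thesis
  proof (rule nth_equalityI)
    fix i assume "i < length (local_rule \<alpha> \<beta> \<alpha>)"
    then show "local_rule \<alpha> \<beta> \<alpha> ! i = \<beta> ! i"
      by (cases i) (simp_all add: nth_local_rule_0 nth_local_rule_Suc c len strip)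
  qed (simp add: len)
qed


text \<open>\<open>\<rho> j\<close> is the row in which shape \<open>j\<close> changes. With the
  sign \<open>d\<close> and the transition \<open>B\<close> as parameters, insertions of a box and
  slides share one theory. Moves are named by rows rather than boxes, so that translating a tableau
  does not affect the name.\<close>

definition box_move ::
    "nat \<Rightarrow> int \<Rightarrow> (shape \<Rightarrow> shape \<Rightarrow> nat \<Rightarrow> nat \<Rightarrow> bool) \<Rightarrow> nat \<Rightarrow> nat \<Rightarrow> tableau \<Rightarrow> tableau \<Rightarrow> bool" where
  "box_move m d B r r' P T \<longleftrightarrow> is_tableau m P \<and> is_tableau m T \<and> length T = length P \<and>
     (\<exists>\<rho>. \<rho> 0 = r \<and> \<rho> (length P - 1) = r' \<and>
       (\<forall>j < length P. \<rho> j < m \<and> T ! j = shift_row d (\<rho> j) (P ! j)) \<and>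
       (\<forall>j. Suc j < length P \<longrightarrow> B (P ! j) (P ! Suc j) (\<rho> j) (\<rho> (Suc j))))"

abbreviation add_move :: "nat \<Rightarrow> nat \<Rightarrow> nat \<Rightarrow> tableau \<Rightarrow> tableau \<Rightarrow> bool" where
  "add_move m \<equiv> box_move m 1 bump"

abbreviation remove_move :: "nat \<Rightarrow> nat \<Rightarrow> nat \<Rightarrow> tableau \<Rightarrow> tableau \<Rightarrow> bool" where
  "remove_move m \<equiv> box_move m (- 1) (descend m)"

text \<open>Start rows and end rows form separate lists: comparing two paths forwards fixes the
  former, backwards the latter.\<close>

inductive move_path ::
    "(nat \<Rightarrow> nat \<Rightarrow> tableau \<Rightarrow> tableau \<Rightarrow> bool) \<Rightarrow> nat list \<Rightarrow> nat list \<Rightarrow> tableau \<Rightarrow> tableau \<Rightarrow> bool"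
  for R where
  Nil: "move_path R [] [] P P"
| snoc: "move_path R rs rs' P X \<Longrightarrow> R r r' X T \<Longrightarrow> move_path R (rs @ [r]) (rs' @ [r']) P T"

lemma move_pathI:
  assumes "Z 0 = P" "Z (length rs) = T" "length rs' = length rs"
    and step: "\<And>t. t < length rs \<Longrightarrow> R (rs ! t) (rs' ! t) (Z t) (Z (Suc t))"
  shows "move_path R rs rs' P T"
proof -
  have "t \<le> length rs \<Longrightarrow> move_path R (take t rs) (take t rs') (Z 0) (Z t)" for t
  proof (induction t)
    case 0
    show ?case by (simp add: move_path.Nil)
  next
    case (Suc t)
    then show ?case
      using move_path.snoc[of R, OF _ step[of t]] assms(3) by (simp add: take_Suc_conv_app_nth)
  qed
  from this[of "length rs"] show ?thesis using assms by simp
qed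

lemma box_move_borders:
  assumes "box_move m d B r r' P T"
  shows "hd T = shift_row d r (hd P)" "last T = shift_row d r' (last P)" "r < m" "r' < m"
    "is_tableau m P" "is_tableau m T" "length T = length P"
proof -
  have "P \<noteq> []" "T \<noteq> []" using assms by (auto simp: box_move_def is_tableau_def)
  then show "hd T = shift_row d r (hd P)" "last T = shift_row d r' (last P)" "r < m" "r' < m"
    "is_tableau m P" "is_tableau m T" "length T = length P"
    using assms by (auto simp: box_move_def hd_conv_nth last_conv_nth)
qed

text \<open>The end rows \<open>a\<close> and \<open>b\<close> are left unrelated, since nothing is
  known about where the same move ends in two related tableaux.\<close>

lemma move_path_relate:
  assumes "move_path R rs a P X" "move_path R rs b P' X'" "E P P'"
    and step: "\<And>r a b P P' T T'. R r a P T \<Longrightarrow> R r b P' T' \<Longrightarrow> E P P' \<Longrightarrow> E T T'"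
  shows "E X X'"
  using assms(1-3)
proof (induction arbitrary: b X' rule: move_path.induct)
  case (Nil P)
  then show ?case by (auto elim: move_path.cases)
next
  case (snoc rs rs' P X r r' T)
  from snoc.prems(1) obtain b1 rb X1 where "move_path R rs b1 P' X1" "R r rb X1 X'"
    by (auto elim: move_path.cases)
  then show ?case using snoc step by blast
qed

lemma move_path_relate_back:
  assumes "move_path R a rs P X" "move_path R b rs P' X'" "E X X'"
    and step: "\<And>r a b P P' T T'. R a r P T \<Longrightarrow> R b r P' T' \<Longrightarrow> E T T' \<Longrightarrow> E P P'"
  shows "E P P'"
  using assms(1-3)
proof (induction arbitrary: b X' rule: move_path.induct)
  case (Nil P)
  then show ?case by (auto elim: move_path.cases)
next
  case (snoc as rs P X a r T)
  from snoc.prems(1) obtain b1 rb X1 where "move_path R b1 rs P' X1" "R rb r X1 X'"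
    by (auto elim: move_path.cases)
  then show ?case using snoc step by blast
qed

lemma is_tableau_mapI:
  assumes "0 < n" "is_shape m (S 0)" "\<And>j. Suc j < n \<Longrightarrow> shape_strip m (S j) (S (Suc j))"
  shows "is_tableau m (map S [0..<n])"
  using assms by (simp add: is_tableau_iff_nth)

lemma box_move_mapI:
  assumes "0 < n" "is_tableau m (map S [0..<n])" "is_tableau m (map S' [0..<n])"
    and "\<And>j. j < n \<Longrightarrow> \<rho> j < m \<and> S' j = shift_row d (\<rho> j) (S j)"
    and "\<And>j. Suc j < n \<Longrightarrow> B (S j) (S (Suc j)) (\<rho> j) (\<rho> (Suc j))"
  shows "box_move m d B (\<rho> 0) (\<rho> (n - 1)) (map S [0..<n]) (map S' [0..<n])"
  unfolding box_move_def using assms by (auto intro!: exI[of _ \<rho>])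

text \<open>
  Lowering all rows but one from the bottom upwards by slides has the same effect as inserting a
  box into the remaining row and then translating by one column. The intermediate shapes are
  \<open>lower_gap i r s\<close>, where \<open>r\<close> is the remaining row: the rows from \<open>i\<close> on have been treated,
  and in addition row \<open>i - 1\<close> once row \<open>r\<close> has been passed over.
\<close>

definition lower_gap :: "nat \<Rightarrow> nat \<Rightarrow> shape \<Rightarrow> shape" where
  "lower_gap i r s = map (\<lambda>x. s ! x - (if i \<le> x \<and> x \<noteq> r \<or> Suc x = i \<and> i \<le> r then 1 else 0)) [0..<length s]"

definition lower_from :: "nat \<Rightarrow> shape \<Rightarrow> shape" where
  "lower_from i s = map (\<lambda>x. s ! x - (if i \<le> x then 1 else 0)) [0..<length s]"

text \<open>As \<open>k\<close> runs from \<open>m - 2\<close> down to 0, this lists the rows other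
  than \<open>r\<close> from the bottom up.\<close>

definition gap_row_up :: "nat \<Rightarrow> nat \<Rightarrow> nat" where
  "gap_row_up k r = (if r \<le> k then Suc k else k)"

lemma lower_gap_simps [simp]:
  "length (lower_gap i r s) = length s"
  "x < length s \<Longrightarrow> lower_gap i r s ! x =
     s ! x - (if i \<le> x \<and> x \<noteq> r \<or> Suc x = i \<and> i \<le> r then 1 else 0)"
  by (simp_all add: lower_gap_def)

lemma lower_from_simps [simp]:
  "length (lower_from i s) = length s"
  "x < length s \<Longrightarrow> lower_from i s ! x = s ! x - (if i \<le> x then 1 else 0)"
  by (simp_all add: lower_from_def)

lemma shape_shift_row_up:
  assumes "is_shape m (shift_row 1 (Suc x) s)" "Suc x < m"
  shows "s ! Suc x < s ! x"
proof -
  have len: "length s = m" using assms by (simp add: is_shape_iff_nth)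
  have "shift_row 1 (Suc x) s ! Suc x \<le> shift_row 1 (Suc x) s ! x"
    using assms by (simp add: is_shape_iff_nth)
  then show ?thesis using assms(2) by (simp add: nth_shift_row len)
qed

lemma shape_shift_row_down:
  assumes "is_shape m (shift_row (- 1) x s)" "Suc x < m"
  shows "s ! Suc x < s ! x"
proof -
  have len: "length s = m" using assms by (simp add: is_shape_iff_nth)
  have "shift_row (- 1) x s ! Suc x \<le> shift_row (- 1) x s ! x"
    using assms by (simp add: is_shape_iff_nth)
  then show ?thesis using assms(2) by (simp add: nth_shift_row len)
qed

text \<open>Two inequalities could fail. If \<open>r \<noteq> r'\<close>, row \<open>r\<close> may
  be lowered in \<open>\<beta>\<close> but not in \<open>\<alpha>\<close>; there
  \<open>\<beta> ! r = \<alpha> ! (r - 1) > \<alpha> ! r\<close>, as row \<open>r\<close> of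
  \<open>\<alpha>\<close> can receive a box. Row \<open>r'\<close> of \<open>\<beta>\<close> is
  spared while the row above it in \<open>\<alpha>\<close> may be lowered; there the stopping
  condition of \<open>bump\<close> is strict.\<close>

lemma lower_gap_strip:
  assumes strip: "shape_strip m \<alpha> \<beta>" and bump: "bump \<alpha> \<beta> r r'" and r: "r < m"
    and shape: "is_shape m (shift_row 1 r \<alpha>)" and i: "0 < i"
  shows "shape_strip m (lower_gap i r \<alpha>) (lower_gap i r' \<beta>)"
proof -
  have len: "length \<alpha> = m" "length \<beta> = m"
    and lo: "\<And>x. x < m \<Longrightarrow> \<alpha> ! x \<le> \<beta> ! x" and hi: "\<And>x. Suc x < m \<Longrightarrow> \<beta> ! Suc x \<le> \<alpha> ! x"
    using strip by (auto simp: shape_strip_iff_nth)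
  have r': "r' \<le> r" using bump by (simp add: bump_def)
  have strict: "\<alpha> ! r < \<beta> ! r" if "r \<noteq> r'"
  proof -
    have "r = Suc (r - 1)" "r' \<le> r - 1" using that r' by auto
    then obtain x where x: "r = Suc x" "r' \<le> x" by blast
    then have "\<alpha> ! Suc x < \<alpha> ! x" using shape_shift_row_up shape r by simp
    then show ?thesis using x bump by (simp add: bump_def)
  qed
  have free: "\<beta> ! Suc x < \<alpha> ! x" if "Suc x = r'" for x
    using bump that by (auto simp: bump_def)
  have "lower_gap i r \<alpha> ! x \<le> lower_gap i r' \<beta> ! x" if "x < m" for x
    using that lo[OF that] strict r' by (cases "x = r"; cases "r = r'") (auto simp: len)
  moreover have "lower_gap i r' \<beta> ! Suc x \<le> lower_gap i r \<alpha> ! x" if "Suc x < m" for x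
    using that hi[OF that] free[of x] i by (cases "Suc x = r'") (auto simp: len)
  ultimately show ?thesis by (simp add: shape_strip_iff_nth len)
qed

text \<open>Applies the strip lemma to the empty strip \<open>\<alpha>/\<alpha>\<close>, through
  which a box that fits into row \<open>r\<close> passes without changing its row.\<close>

lemma lower_gap_shape:
  assumes "is_shape m \<alpha>" "r < m" "is_shape m (shift_row 1 r \<alpha>)" "0 < i"
  shows "is_shape m (lower_gap i r \<alpha>)"
proof -
  have "shape_strip m \<alpha> \<alpha>" using assms by (simp add: shape_strip_def horizontal_strip_refl)
  moreover have "bump \<alpha> \<alpha> r r" using assms shape_shift_row_up by (auto simp: bump_def)
  ultimately have "shape_strip m (lower_gap i r \<alpha>) (lower_gap i r \<alpha>)"
    using assms by (intro lower_gap_strip)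
  then show ?thesis by (simp add: shape_strip_def)
qed

lemma lower_gap_step:
  assumes "length s = m" "Suc k < m" "r < m"
  shows "lower_gap (Suc k) r s = shift_row (- 1) (gap_row_up k r) (lower_gap (Suc (Suc k)) r s)"
proof (rule nth_equalityI)
  fix x assume "x < length (lower_gap (Suc k) r s)"
  then have x: "x < length s" by simp
  have "(Suc k \<le> x \<and> x \<noteq> r \<or> x = k \<and> Suc k \<le> r) \<longleftrightarrow>
      (Suc (Suc k) \<le> x \<and> x \<noteq> r \<or> x = Suc k \<and> Suc (Suc k) \<le> r) \<or> x = gap_row_up k r"
    "x = gap_row_up k r \<Longrightarrow> \<not> (Suc (Suc k) \<le> x \<and> x \<noteq> r \<or> x = Suc k \<and> Suc (Suc k) \<le> r)"
    by (simp_all add: gap_row_up_def) arith+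
  with x show "lower_gap (Suc k) r s ! x =
      shift_row (- 1) (gap_row_up k r) (lower_gap (Suc (Suc k)) r s) ! x"
    by (cases "x = gap_row_up k r") (simp_all add: nth_shift_row)
qed simp

text \<open>The slide steps down precisely if \<open>r' \<le> k < r\<close>, that is, where the
  inserted box is bumped from row \<open>Suc k\<close> to row \<open>k\<close> and
  \<open>\<beta> ! Suc k = \<alpha> ! k\<close>. Otherwise the row below is too short, because it
  has been lowered already or, for \<open>r' = Suc k\<close>, by the stopping condition of
  \<open>bump\<close>.\<close>

lemma lower_gap_descend:
  assumes strip: "shape_strip m \<alpha> \<beta>" and bump: "bump \<alpha> \<beta> r r'" and "r < m" and k: "Suc k < m"
  shows "descend m (lower_gap (Suc (Suc k)) r \<alpha>) (lower_gap (Suc (Suc k)) r' \<beta>)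
    (gap_row_up k r) (gap_row_up k r')"
proof -
  have len: "length \<alpha> = m" "length \<beta> = m"
    and hi: "\<And>x. Suc x < m \<Longrightarrow> \<beta> ! Suc x \<le> \<alpha> ! x"
    using strip by (auto simp: shape_strip_iff_nth)
  have r': "r' \<le> r" using bump by (simp add: bump_def)
  consider "r \<le> k" | "k < r" "r' \<le> k" | "k < r'" using r' by linarith
  then show ?thesis
  proof cases
    case 1
    then show ?thesis
      using r' k hi[of "Suc k"] by (auto simp: descend_def gap_row_up_def len)
  next
    case 2
    then have "\<beta> ! Suc k = \<alpha> ! k" using bump by (simp add: bump_def)
    then show ?thesis using 2 k by (auto simp: descend_def gap_row_up_def len)
  next
    case 3
    have "\<beta> ! Suc k < \<alpha> ! k \<or> Suc (Suc k) \<le> r'"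
      using bump 3 by (cases "r' = Suc k") (auto simp: bump_def)
    then show ?thesis
      using 3 r' k hi[of k] by (auto simp: descend_def gap_row_up_def len)
  qed
qed

lemma lower_from_strip:
  assumes "shape_strip m \<alpha> \<beta>"
  shows "shape_strip m (lower_from i \<alpha>) (lower_from i \<beta>)"
proof -
  have len: "length \<alpha> = m" "length \<beta> = m"
    and lo: "\<And>x. x < m \<Longrightarrow> \<alpha> ! x \<le> \<beta> ! x" and hi: "\<And>x. Suc x < m \<Longrightarrow> \<beta> ! Suc x \<le> \<alpha> ! x"
    using assms by (auto simp: shape_strip_iff_nth)
  have "lower_from i \<alpha> ! x \<le> lower_from i \<beta> ! x" if "x < m" for x
    using that lo[OF that] by (simp add: len)
  moreover have "lower_from i \<beta> ! Suc x \<le> lower_from i \<alpha> ! x" if "Suc x < m" for x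
    using that hi[OF that] by (simp add: len)
  ultimately show ?thesis by (simp add: shape_strip_iff_nth len)
qed

lemma lower_from_step:
  "length s = m \<Longrightarrow> k < m \<Longrightarrow> lower_from k s = shift_row (- 1) k (lower_from (Suc k) s)"
  by (intro nth_equalityI) (auto simp: nth_shift_row)

lemma lower_from_descend:
  assumes "shape_strip m \<alpha> \<beta>"
  shows "descend m (lower_from (Suc k) \<alpha>) (lower_from (Suc k) \<beta>) k k"
proof -
  have "Suc k < m \<Longrightarrow> \<beta> ! Suc k \<le> \<alpha> ! k" "length \<alpha> = m" "length \<beta> = m"
    using assms by (auto simp: shape_strip_iff_nth)
  then show ?thesis by (auto simp: descend_def)
qed

lemma lower_gap_bottom: "length s = m \<Longrightarrow> r < m \<Longrightarrow> lower_gap m r s = s"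
  by (rule nth_equalityI) auto

lemma lower_from_bottom: "length s = m \<Longrightarrow> lower_from m s = s"
  by (rule nth_equalityI) auto

lemma lower_from_0_shift_row:
  "r < length s \<Longrightarrow> lower_from 0 (shift_row 1 r s) = lower_gap (Suc 0) r s"
  by (rule nth_equalityI) (auto simp: nth_shift_row)

text \<open>The list of start rows involves only \<open>r\<close> and that of end rows only
  \<open>r'\<close>, so the simulation can be compared for two tableaux that share just one end of
  the move.\<close>

lemma add_move_by_remove_moves:
  assumes "add_move m r r' P T"
  shows "\<exists>X. move_path (remove_move m)
      (map (\<lambda>t. gap_row_up (m - 2 - t) r) [0..<m - 1]) (map (\<lambda>t. gap_row_up (m - 2 - t) r') [0..<m - 1]) P X \<and>
    move_path (remove_move m) (rev [0..<m]) (rev [0..<m]) T X"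
proof -
  let ?n = "length P"
  obtain \<rho> where \<rho>: "\<rho> 0 = r" "\<rho> (?n - 1) = r'"
    "\<And>j. j < ?n \<Longrightarrow> \<rho> j < m" "\<And>j. j < ?n \<Longrightarrow> T ! j = shift_row 1 (\<rho> j) (P ! j)"
    "\<And>j. Suc j < ?n \<Longrightarrow> bump (P ! j) (P ! Suc j) (\<rho> j) (\<rho> (Suc j))"
    and tab: "is_tableau m P" "is_tableau m T" and len: "length T = ?n"
    using assms by (auto simp: box_move_def)
  have n: "0 < ?n" using tab by (simp add: is_tableau_def)
  have shapes: "is_shape m (P ! j)" "is_shape m (shift_row 1 (\<rho> j) (P ! j))" "length (P ! j) = m"
    if "j < ?n" for j
    using that tab len is_tableau_nth_shape[of m P j] is_tableau_nth_shape[of m T j] \<rho>(4)[of j]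
    by (auto simp: is_shape_length)
  have strips: "shape_strip m (P ! j) (P ! Suc j)" "shape_strip m (T ! j) (T ! Suc j)"
    if "Suc j < ?n" for j
    using that tab len by (auto simp: is_tableau_nth_strip)
  have m: "0 < m" using \<rho>(3)[OF n] by simp
  \<comment> \<open>\<open>t\<close> counts the moves made. \<open>Z\<close> starts from
    \<open>P\<close> and spares one row, \<open>W\<close> starts from \<open>T\<close> and spares
    none; they meet after \<open>m - 1\<close> and \<open>m\<close> moves respectively.\<close>
  define Z where "Z t = map (\<lambda>j. lower_gap (m - t) (\<rho> j) (P ! j)) [0..<?n]" for t
  define W where "W t = map (\<lambda>j. lower_from (m - t) (T ! j)) [0..<?n]" for t
  have Z_tab: "is_tableau m (Z t)" if "t < m" for t
    unfolding Z_def using that n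
    by (intro is_tableau_mapI lower_gap_shape lower_gap_strip shapes strips \<rho>(3,5)) simp_all
  have W_tab: "is_tableau m (W t)" for t
  proof -
    have "shape_strip m (T ! 0) (T ! 0)"
      using is_tableau_nth_shape[OF tab(2), of 0] n len
      by (simp add: shape_strip_def horizontal_strip_refl[of m])
    then have "is_shape m (lower_from (m - t) (T ! 0))"
      using lower_from_strip by (auto simp: shape_strip_def)
    then show ?thesis
      unfolding W_def using n strips by (intro is_tableau_mapI lower_from_strip) auto
  qed
  have "Z 0 = P"
    by (rule nth_equalityI) (simp_all add: Z_def lower_gap_bottom shapes \<rho>(3))
  moreover have "W 0 = T"
    by (rule nth_equalityI) (simp_all add: W_def lower_from_bottom shapes \<rho>(4) len)
  moreover have "Z (m - 1) = W m"
    using m by (intro nth_equalityI) (simp_all add: Z_def W_def \<rho>(3,4) lower_from_0_shift_row shapes)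
  moreover have "remove_move m (gap_row_up (m - 2 - t) r) (gap_row_up (m - 2 - t) r') (Z t) (Z (Suc t))"
    if t: "t < m - 1" for t
  proof -
    define k where "k = m - 2 - t"
    have k: "m - t = Suc (Suc k)" "m - Suc t = Suc k" "Suc k < m" using t by (auto simp: k_def)
    have "remove_move m (gap_row_up k (\<rho> 0)) (gap_row_up k (\<rho> (?n - 1))) (Z t) (Z (Suc t))"
      unfolding Z_def
    proof (rule box_move_mapI[where \<rho> = "\<lambda>j. gap_row_up k (\<rho> j)"])
      fix j assume j: "j < ?n"
      show "gap_row_up k (\<rho> j) < m \<and> lower_gap (m - Suc t) (\<rho> j) (P ! j) =
          shift_row (- 1) (gap_row_up k (\<rho> j)) (lower_gap (m - t) (\<rho> j) (P ! j))"
        using k lower_gap_step[of "P ! j" m k "\<rho> j"] shapes[OF j] \<rho>(3)[OF j]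
        by (simp add: gap_row_up_def)
    next
      fix j assume j: "Suc j < ?n"
      show "descend m (lower_gap (m - t) (\<rho> j) (P ! j)) (lower_gap (m - t) (\<rho> (Suc j)) (P ! Suc j))
          (gap_row_up k (\<rho> j)) (gap_row_up k (\<rho> (Suc j)))"
        using lower_gap_descend[OF strips(1)[OF j] \<rho>(5)[OF j] _ k(3)] \<rho>(3)[of j] j k by simp
    qed (use n t Z_tab[of t] Z_tab[of "Suc t"] in \<open>auto simp: Z_def\<close>)
    then show ?thesis unfolding \<rho>(1,2) k_def .
  qed
  moreover have "remove_move m (rev [0..<m] ! t) (rev [0..<m] ! t) (W t) (W (Suc t))"
    if t: "t < m" for t
  proof -
    define k where "k = m - Suc t"
    have k: "m - t = Suc k" "m - Suc t = k" "k < m" using t by (auto simp: k_def)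
    have "remove_move m k k (W t) (W (Suc t))"
      unfolding W_def
    proof (rule box_move_mapI[where \<rho> = "\<lambda>j. k"])
      fix j assume j: "j < ?n"
      show "k < m \<and> lower_from (m - Suc t) (T ! j) = shift_row (- 1) k (lower_from (m - t) (T ! j))"
        using k lower_from_step[of "T ! j" m k] tab(2) j len
        by (simp add: is_tableau_nth_shape[THEN is_shape_length])
    next
      fix j assume j: "Suc j < ?n"
      show "descend m (lower_from (m - t) (T ! j)) (lower_from (m - t) (T ! Suc j)) k k"
        using lower_from_descend[OF strips(2)[OF j]] k by simp
    qed (use n W_tab[of t] W_tab[of "Suc t"] in \<open>auto simp: W_def\<close>)
    then show ?thesis using t by (simp add: rev_nth k_def)
  qed
  ultimately have
    "move_path (remove_move m) (map (\<lambda>t. gap_row_up (m - 2 - t) r) [0..<m - 1])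
      (map (\<lambda>t. gap_row_up (m - 2 - t) r') [0..<m - 1]) P (W m)"
    "move_path (remove_move m) (rev [0..<m]) (rev [0..<m]) T (W m)"
    by (auto intro: move_pathI[of Z] move_pathI[of W])
  then show ?thesis by blast
qed


text \<open>Conversely, inserting boxes into all rows but \<open>r\<close> from the top downwards amounts to a slide.\<close>

definition raise_gap :: "nat \<Rightarrow> nat \<Rightarrow> shape \<Rightarrow> shape" where
  "raise_gap k r s = map (\<lambda>x. s ! x + (if x < k \<and> x \<noteq> r \<or> x = k \<and> r < k then 1 else 0)) [0..<length s]"

definition raise_upto :: "nat \<Rightarrow> shape \<Rightarrow> shape" where
  "raise_upto k s = map (\<lambda>x. s ! x + (if x < k then 1 else 0)) [0..<length s]"

text \<open>As \<open>k\<close> runs from 0 to \<open>m - 2\<close>, this lists the rows other than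
  \<open>r\<close> from the top down.\<close>

definition gap_row_down :: "nat \<Rightarrow> nat \<Rightarrow> nat" where
  "gap_row_down k r = (if k < r then k else Suc k)"

lemma raise_gap_simps [simp]:
  "length (raise_gap k r s) = length s"
  "x < length s \<Longrightarrow> raise_gap k r s ! x =
     s ! x + (if x < k \<and> x \<noteq> r \<or> x = k \<and> r < k then 1 else 0)"
  by (simp_all add: raise_gap_def)

lemma raise_upto_simps [simp]:
  "length (raise_upto k s) = length s"
  "x < length s \<Longrightarrow> raise_upto k s ! x = s ! x + (if x < k then 1 else 0)"
  by (simp_all add: raise_upto_def)

text \<open>The rows raised in \<open>\<alpha>\<close> and in \<open>\<beta>\<close> differ at most
  in \<open>r\<close> and \<open>r'\<close>. If the slide descends,
  \<open>\<beta> ! r' = \<alpha> ! r > \<alpha> ! r'\<close> preserves containment in row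
  \<open>r'\<close>; if not, \<open>\<beta> ! Suc r < \<alpha> ! r\<close> leaves room for raising
  row \<open>Suc r\<close> of \<open>\<beta>\<close>.\<close>

lemma raise_gap_strip:
  assumes strip: "shape_strip m \<alpha> \<beta>" and desc: "descend m \<alpha> \<beta> r r'"
    and shape: "is_shape m (shift_row (- 1) r \<alpha>)"
  shows "shape_strip m (raise_gap k r \<alpha>) (raise_gap k r' \<beta>)"
proof -
  have len: "length \<alpha> = m" "length \<beta> = m"
    and lo: "\<And>x. x < m \<Longrightarrow> \<alpha> ! x \<le> \<beta> ! x" and hi: "\<And>x. Suc x < m \<Longrightarrow> \<beta> ! Suc x \<le> \<alpha> ! x"
    using strip by (auto simp: shape_strip_iff_nth)
  have strict: "\<alpha> ! x < \<beta> ! x" if "r \<noteq> r'" "x = r'" for x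
    using that desc shape_shift_row_down[OF shape] by (auto simp: descend_def split: if_splits)
  have free: "\<beta> ! Suc r < \<alpha> ! r" if "r = r'" "Suc r < m"
    using that desc hi[of r] by (auto simp: descend_def split: if_splits)
  have r': "r' = r \<or> r' = Suc r" using desc by (auto simp: descend_def)
  define D where "D x r \<longleftrightarrow> x < k \<and> x \<noteq> r \<or> x = k \<and> r < k" for x r
  have D: "D x r \<Longrightarrow> \<not> D x r' \<Longrightarrow> x = r' \<and> r \<noteq> r'" "D (Suc x) r' \<Longrightarrow> \<not> D x r \<Longrightarrow> x = r \<and> r = r'" for x
    unfolding D_def using r' by arith+
  have nth: "raise_gap k r \<alpha> ! x = \<alpha> ! x + (if D x r then 1 else 0)"
    "raise_gap k r' \<beta> ! x = \<beta> ! x + (if D x r' then 1 else 0)" if "x < m" for x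
    using that by (simp_all add: len D_def)
  have "raise_gap k r \<alpha> ! x \<le> raise_gap k r' \<beta> ! x" if "x < m" for x
    using that lo[OF that] strict D(1)[of x] nth[of x]
    by (cases "D x r"; cases "D x r'") auto
  moreover have "raise_gap k r' \<beta> ! Suc x \<le> raise_gap k r \<alpha> ! x" if "Suc x < m" for x
    using that hi[OF that] free D(2)[of x] nth(1)[of x] nth(2)[of "Suc x"]
    by (cases "D (Suc x) r'"; cases "D x r") auto
  ultimately show ?thesis by (simp add: shape_strip_iff_nth len)
qed

lemma raise_gap_shape:
  assumes "is_shape m \<alpha>" "is_shape m (shift_row (- 1) r \<alpha>)"
  shows "is_shape m (raise_gap k r \<alpha>)"
proof -
  have "shape_strip m \<alpha> \<alpha>" using assms by (simp add: shape_strip_def horizontal_strip_refl)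
  moreover have "descend m \<alpha> \<alpha> r r"
    using shape_shift_row_down[OF assms(2)] by (auto simp: descend_def)
  ultimately have "shape_strip m (raise_gap k r \<alpha>) (raise_gap k r \<alpha>)"
    using assms by (intro raise_gap_strip)
  then show ?thesis by (simp add: shape_strip_def)
qed

lemma raise_gap_step:
  assumes "length s = m" "Suc k < m"
  shows "raise_gap (Suc k) r s = shift_row 1 (gap_row_down k r) (raise_gap k r s)"
proof (rule nth_equalityI)
  fix x assume "x < length (raise_gap (Suc k) r s)"
  then have x: "x < length s" by simp
  have "(x < Suc k \<and> x \<noteq> r \<or> x = Suc k \<and> r < Suc k) \<longleftrightarrow>
      (x < k \<and> x \<noteq> r \<or> x = k \<and> r < k) \<or> x = gap_row_down k r"
    "x = gap_row_down k r \<Longrightarrow> \<not> (x < k \<and> x \<noteq> r \<or> x = k \<and> r < k)"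
    by (simp_all add: gap_row_down_def) arith+
  with x show "raise_gap (Suc k) r s ! x = shift_row 1 (gap_row_down k r) (raise_gap k r s) ! x"
    by (cases "x = gap_row_down k r") (simp_all add: nth_shift_row)
qed simp

text \<open>The inserted box is bumped up only at the stage \<open>k = r\<close>, and only if the
  slide descends, when \<open>\<beta> ! Suc r = \<alpha> ! r\<close> blocks it. In all other cases
  there is room, because the row above has been raised already or
  \<open>\<beta> ! Suc r < \<alpha> ! r\<close>.\<close>

lemma raise_gap_bump:
  assumes strip: "shape_strip m \<alpha> \<beta>" and desc: "descend m \<alpha> \<beta> r r'" and k: "Suc k < m"
  shows "bump (raise_gap k r \<alpha>) (raise_gap k r' \<beta>) (gap_row_down k r) (gap_row_down k r')"
proof -
  have len: "length \<alpha> = m" "length \<beta> = m"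
    and hi: "\<And>x. Suc x < m \<Longrightarrow> \<beta> ! Suc x \<le> \<alpha> ! x"
    using strip by (auto simp: shape_strip_iff_nth)
  have free: "\<beta> ! Suc r < \<alpha> ! r" if "r = r'" "Suc r < m"
    using that desc hi[of r] by (auto simp: descend_def split: if_splits)
  have blocked: "\<beta> ! Suc r = \<alpha> ! r" if "r \<noteq> r'"
    using that desc by (auto simp: descend_def split: if_splits)
  have r': "r' = r \<or> r' = Suc r" using desc by (auto simp: descend_def)
  have hi': "\<beta> ! Suc x < \<alpha> ! x + 1" if "Suc x < m" for x using hi[OF that] by simp
  consider "k < r" | "k = r" "r' = r" | "k = r" "r' = Suc r" | "r < k" using r' by linarith
  then show ?thesis
  proof cases
    case 1
    then have "gap_row_down k r = k" "gap_row_down k r' = k" using r' by (auto simp: gap_row_down_def)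
    then show ?thesis using 1 r' k hi' by (auto simp: bump_def len)
  next
    case 2
    then show ?thesis using k free by (auto simp: bump_def len gap_row_down_def)
  next
    case 3
    then have "gap_row_down k r = Suc k" "gap_row_down k r' = k" by (auto simp: gap_row_down_def)
    then show ?thesis using 3 k hi' blocked by (auto simp: bump_def len le_less_Suc_eq)
  next
    case 4
    then have "gap_row_down k r = Suc k" "gap_row_down k r' = Suc k"
      using r' by (auto simp: gap_row_down_def)
    then show ?thesis using 4 k hi' by (auto simp: bump_def len)
  qed
qed

lemma raise_upto_strip:
  assumes "shape_strip m \<alpha> \<beta>"
  shows "shape_strip m (raise_upto k \<alpha>) (raise_upto k \<beta>)"
proof -
  have len: "length \<alpha> = m" "length \<beta> = m"
    and lo: "\<And>x. x < m \<Longrightarrow> \<alpha> ! x \<le> \<beta> ! x" and hi: "\<And>x. Suc x < m \<Longrightarrow> \<beta> ! Suc x \<le> \<alpha> ! x"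
    using assms by (auto simp: shape_strip_iff_nth)
  have "raise_upto k \<alpha> ! x \<le> raise_upto k \<beta> ! x" if "x < m" for x
    using that lo[OF that] by (simp add: len)
  moreover have "raise_upto k \<beta> ! Suc x \<le> raise_upto k \<alpha> ! x" if "Suc x < m" for x
    using that hi[OF that] by (simp add: len)
  ultimately show ?thesis by (simp add: shape_strip_iff_nth len)
qed

lemma raise_upto_step:
  "length s = m \<Longrightarrow> k < m \<Longrightarrow> raise_upto (Suc k) s = shift_row 1 k (raise_upto k s)"
  by (intro nth_equalityI) (auto simp: nth_shift_row)

lemma raise_upto_bump:
  assumes "shape_strip m \<alpha> \<beta>" "k < m"
  shows "bump (raise_upto k \<alpha>) (raise_upto k \<beta>) k k"
proof -
  have "Suc x < m \<Longrightarrow> \<beta> ! Suc x < \<alpha> ! x + 1" for x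
    using assms by (force simp: shape_strip_iff_nth)
  moreover have "length \<alpha> = m" "length \<beta> = m" using assms by (auto simp: shape_strip_iff_nth)
  ultimately show ?thesis using assms(2) by (auto simp: bump_def)
qed

lemma raise_gap_top: "length s = m \<Longrightarrow> raise_gap 0 r s = s"
  by (rule nth_equalityI) auto

lemma raise_upto_top: "raise_upto 0 s = s"
  by (rule nth_equalityI) auto

lemma raise_upto_shift_row:
  "r < m \<Longrightarrow> length s = m \<Longrightarrow> raise_upto m (shift_row (- 1) r s) = raise_gap (m - 1) r s"
  by (rule nth_equalityI) (auto simp: nth_shift_row)

lemma remove_move_by_add_moves:
  assumes "remove_move m r r' P T"
  shows "\<exists>X. move_path (add_move m)
      (map (\<lambda>k. gap_row_down k r) [0..<m - 1]) (map (\<lambda>k. gap_row_down k r') [0..<m - 1]) P X \<and>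
    move_path (add_move m) [0..<m] [0..<m] T X"
proof -
  let ?n = "length P"
  obtain \<rho> where \<rho>: "\<rho> 0 = r" "\<rho> (?n - 1) = r'"
    "\<And>j. j < ?n \<Longrightarrow> \<rho> j < m" "\<And>j. j < ?n \<Longrightarrow> T ! j = shift_row (- 1) (\<rho> j) (P ! j)"
    "\<And>j. Suc j < ?n \<Longrightarrow> descend m (P ! j) (P ! Suc j) (\<rho> j) (\<rho> (Suc j))"
    and tab: "is_tableau m P" "is_tableau m T" and len: "length T = ?n"
    using assms by (auto simp: box_move_def)
  have n: "0 < ?n" using tab by (simp add: is_tableau_def)
  have shapes: "is_shape m (P ! j)" "is_shape m (shift_row (- 1) (\<rho> j) (P ! j))" "length (P ! j) = m"
    if "j < ?n" for j
    using that tab len is_tableau_nth_shape[of m P j] is_tableau_nth_shape[of m T j] \<rho>(4)[of j]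
    by (auto simp: is_shape_length)
  have strips: "shape_strip m (P ! j) (P ! Suc j)" "shape_strip m (T ! j) (T ! Suc j)"
    if "Suc j < ?n" for j
    using that tab len by (auto simp: is_tableau_nth_strip)
  define Z where "Z k = map (\<lambda>j. raise_gap k (\<rho> j) (P ! j)) [0..<?n]" for k
  define W where "W k = map (\<lambda>j. raise_upto k (T ! j)) [0..<?n]" for k
  have Z_tab: "is_tableau m (Z k)" for k
    unfolding Z_def using n
    by (intro is_tableau_mapI raise_gap_shape raise_gap_strip shapes strips \<rho>(5)) simp_all
  have W_tab: "is_tableau m (W k)" for k
  proof -
    have "shape_strip m (T ! 0) (T ! 0)"
      using is_tableau_nth_shape[OF tab(2), of 0] n len
      by (simp add: shape_strip_def horizontal_strip_refl[of m])
    then have "is_shape m (raise_upto k (T ! 0))"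
      using raise_upto_strip by (auto simp: shape_strip_def)
    then show ?thesis
      unfolding W_def using n strips by (intro is_tableau_mapI raise_upto_strip) auto
  qed
  have "Z 0 = P"
    by (rule nth_equalityI) (simp_all add: Z_def raise_gap_top shapes)
  moreover have "W 0 = T"
    by (rule nth_equalityI) (simp_all add: W_def raise_upto_top len)
  moreover have "Z (m - 1) = W m"
    by (rule nth_equalityI) (simp_all add: Z_def W_def \<rho>(3,4) raise_upto_shift_row shapes)
  moreover have "add_move m (gap_row_down k r) (gap_row_down k r') (Z k) (Z (Suc k))"
    if k: "k < m - 1" for k
  proof -
    have "add_move m (gap_row_down k (\<rho> 0)) (gap_row_down k (\<rho> (?n - 1))) (Z k) (Z (Suc k))"
      unfolding Z_def
    proof (rule box_move_mapI[where \<rho> = "\<lambda>j. gap_row_down k (\<rho> j)"])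
      fix j assume j: "j < ?n"
      show "gap_row_down k (\<rho> j) < m \<and> raise_gap (Suc k) (\<rho> j) (P ! j) =
          shift_row 1 (gap_row_down k (\<rho> j)) (raise_gap k (\<rho> j) (P ! j))"
        using raise_gap_step[of "P ! j" m k "\<rho> j"] shapes[OF j] \<rho>(3)[OF j] less_diff_conv k
        by (auto simp: gap_row_down_def)
    next
      fix j assume j: "Suc j < ?n"
      show "bump (raise_gap k (\<rho> j) (P ! j)) (raise_gap k (\<rho> (Suc j)) (P ! Suc j))
          (gap_row_down k (\<rho> j)) (gap_row_down k (\<rho> (Suc j)))"
        using raise_gap_bump[OF strips(1)[OF j] \<rho>(5)[OF j]] k by simp
    qed (use n Z_tab[of k] Z_tab[of "Suc k"] in \<open>auto simp: Z_def\<close>)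
    then show ?thesis unfolding \<rho>(1,2) .
  qed
  moreover have "add_move m k k (W k) (W (Suc k))" if k: "k < m" for k
    unfolding W_def
  proof (rule box_move_mapI[where \<rho> = "\<lambda>j. k"])
    fix j assume j: "j < ?n"
    show "k < m \<and> raise_upto (Suc k) (T ! j) = shift_row 1 k (raise_upto k (T ! j))"
      using k raise_upto_step[of "T ! j" m k] tab(2) j len
      by (simp add: is_tableau_nth_shape[THEN is_shape_length])
  next
    fix j assume j: "Suc j < ?n"
    show "bump (raise_upto k (T ! j)) (raise_upto k (T ! Suc j)) k k"
      using raise_upto_bump[OF strips(2)[OF j] k] by simp
  qed (use n W_tab[of k] W_tab[of "Suc k"] in \<open>auto simp: W_def\<close>)
  ultimately have
    "move_path (add_move m) (map (\<lambda>k. gap_row_down k r) [0..<m - 1])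
      (map (\<lambda>k. gap_row_down k r') [0..<m - 1]) P (W m)"
    "move_path (add_move m) [0..<m] [0..<m] T (W m)"
    by (auto intro: move_pathI[of Z] move_pathI[of W])
  then show ?thesis by blast
qed


section \<open>Inserting a strip box by box\<close>

text \<open>Two consecutive rows of a growth diagram. The inserted strip is present only as the
  difference of the inner borders, so it can be shortened box by box.\<close>

definition strip_insert :: "nat \<Rightarrow> tableau \<Rightarrow> tableau \<Rightarrow> bool" where
  "strip_insert m P T \<longleftrightarrow> is_tableau m P \<and> is_tableau m T \<and> length T = length P \<and>
     (\<forall>j < length P. shape_strip m (P ! j) (T ! j)) \<and>
     (\<forall>j. Suc j < length P \<longrightarrow> T ! Suc j = local_rule (P ! j) (P ! Suc j) (T ! j))"

lemma growth_strip_insert: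
  "growth m p q G \<Longrightarrow> i < q \<Longrightarrow> strip_insert m (growth_row G p i) (growth_row G p (Suc i))"
  by (auto simp: strip_insert_def growth_row_tableau) (auto simp: growth_def growth_square_def)

lemma strip_insert_exists:
  assumes "is_tableau m P" "shape_strip m (P ! 0) \<gamma>"
  shows "\<exists>T. strip_insert m P T \<and> T ! 0 = \<gamma>"
proof -
  have ne: "P \<noteq> []" using assms by (simp add: is_tableau_def)
  then have "(P, [P ! 0, \<gamma>]) \<in> inner_pairs m"
    using assms by (auto simp: inner_pairs_def is_tableau_def hd_conv_nth shape_strip_def)
  then obtain G where G: "growth m (length P - 1) 1 G" "P = growth_row G (length P - 1) 0"
    "[P ! 0, \<gamma>] = growth_col G 1 0"
    by (rule inner_pair_growth) simp
  have "G 1 0 = \<gamma>" using arg_cong[OF G(3), of last] by simp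
  then have "growth_row G (length P - 1) 1 ! 0 = \<gamma>" by simp
  then show ?thesis using growth_strip_insert[OF G(1), of 0] G(2) by auto
qed

lemma strip_insert_unique:
  assumes "strip_insert m P T" "strip_insert m P T'" "T ! 0 = T' ! 0"
  shows "T = T'"
proof (rule nth_equalityI)
  show "length T = length T'" using assms by (simp add: strip_insert_def)
  fix j assume "j < length T"
  then have "j < length P" using assms by (simp add: strip_insert_def)
  then show "T ! j = T' ! j"
    by (induction j) (use assms in \<open>auto simp: strip_insert_def\<close>)
qed

lemma strip_insert_refl: "is_tableau m P \<Longrightarrow> strip_insert m P P"
  by (auto simp: strip_insert_def local_rule_trivial[OF is_tableau_nth_strip])
    (auto simp: shape_strip_def is_tableau_nth_shape horizontal_strip_refl[of m])

text \<open>Row \<open>r\<close> is the topmost row of the inserted strip; one of its boxes is held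
  back, and \<open>local_rule_bump\<close> then carries it through the chain, strip by strip. The
  final clause keeps the end rows in order as well.\<close>

lemma strip_insert_last_box:
  assumes PT: "strip_insert m P T" and r: "r < m" "P ! 0 ! r < T ! 0 ! r"
    and top: "\<And>i. i < r \<Longrightarrow> T ! 0 ! i = P ! 0 ! i"
  shows "\<exists>T' r'. strip_insert m P T' \<and> add_move m r r' T' T \<and>
    (\<forall>i < r'. last T' ! i = last P ! i)"
proof -
  let ?n = "length P"
  have n: "0 < ?n" and tab: "is_tableau m P" "is_tableau m T" and len: "length T = ?n"
    and rule: "\<And>j. Suc j < ?n \<Longrightarrow> T ! Suc j = local_rule (P ! j) (P ! Suc j) (T ! j)"
    and strip0: "shape_strip m (P ! 0) (T ! 0)"
    using PT by (auto simp: strip_insert_def is_tableau_def)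
  have len0: "length (P ! 0) = m" "length (T ! 0) = m" using strip0 by (auto simp: shape_strip_iff_nth)
  have "P ! 0 ! i \<le> shift_row (- 1) r (T ! 0) ! i" if "i < m" for i
    using that strip0 r by (auto simp: shape_strip_iff_nth nth_shift_row)
  moreover have "shift_row (- 1) r (T ! 0) ! Suc i \<le> P ! 0 ! i" if "Suc i < m" for i
  proof -
    have "T ! 0 ! Suc i \<le> P ! 0 ! i" using that strip0 by (simp add: shape_strip_iff_nth)
    then show ?thesis using that by (cases "Suc i = r") (auto simp: nth_shift_row len0)
  qed
  ultimately have "shape_strip m (P ! 0) (shift_row (- 1) r (T ! 0))"
    by (simp add: shape_strip_iff_nth len0)
  then obtain T' where T': "strip_insert m P T'" "T' ! 0 = shift_row (- 1) r (T ! 0)"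
    using strip_insert_exists tab(1) by blast
  have tab': "is_tableau m T'" and len': "length T' = ?n"
    and strip': "\<And>j. j < ?n \<Longrightarrow> shape_strip m (P ! j) (T' ! j)"
    and rule': "\<And>j. Suc j < ?n \<Longrightarrow> T' ! Suc j = local_rule (P ! j) (P ! Suc j) (T' ! j)"
    using T'(1) by (auto simp: strip_insert_def)
  \<comment> \<open>The held-back box changes shape \<open>j\<close> in row \<open>r\<close>, and
    the boxes inserted before it lie in no higher row: exactly what \<open>local_rule_bump\<close>
    requires for the next strip.\<close>
  define I where "I j r \<longleftrightarrow> r < m \<and> T ! j = shift_row 1 r (T' ! j) \<and> (\<forall>i < r. T' ! j ! i = P ! j ! i)"
    for j r
  have "T ! 0 = shift_row 1 r (T' ! 0)"
    unfolding T'(2) using len0 by (intro nth_equalityI) (auto simp: nth_shift_row)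
  then have I0: "I 0 r"
    using r(1) top len0 by (simp add: I_def T'(2) nth_shift_row)
  have I_step: "\<exists>r'. I (Suc j) r' \<and> bump (T' ! j) (T' ! Suc j) r r'" if j: "Suc j < ?n" and I: "I j r" for j r
  proof -
    have "shape_strip m (T' ! j) (T' ! Suc j)"
      using tab' len' j by (simp add: is_tableau_nth_strip)
    moreover have "r < m" using I by (simp add: I_def)
    ultimately have "T' ! Suc j ! Suc i \<le> T' ! j ! i" if "i < r" for i
      using that by (simp add: shape_strip_iff_nth)
    then obtain r' where b: "bump (T' ! j) (T' ! Suc j) r r'"
      using bump_exists by blast
    have "T ! Suc j = shift_row 1 r' (T' ! Suc j)" "\<forall>i < r'. T' ! Suc j ! i = P ! Suc j ! i"
      using local_rule_bump[OF is_tableau_nth_strip[OF tab(1) j] strip', of r r'] b I j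
      by (auto simp: I_def rule[OF j] rule'[OF j])
    moreover have "r' < m" using b \<open>r < m\<close> by (simp add: bump_def)
    ultimately show ?thesis using b unfolding I_def by blast
  qed
  obtain \<rho> where \<rho>: "\<rho> 0 = r" "\<And>j. j < ?n \<Longrightarrow> I j (\<rho> j)"
    "\<And>j. Suc j < ?n \<Longrightarrow> bump (T' ! j) (T' ! Suc j) (\<rho> j) (\<rho> (Suc j))"
  proof -
    have "\<exists>f. \<forall>j. ((j = 0 \<longrightarrow> f j = r) \<and> (j < ?n \<longrightarrow> I j (f j))) \<and>
        (Suc j < ?n \<longrightarrow> bump (T' ! j) (T' ! Suc j) (f j) (f (Suc j)))"
    proof (rule dependent_nat_choice)
      show "\<exists>x. (0 = 0 \<longrightarrow> x = r) \<and> (0 < ?n \<longrightarrow> I 0 x)" using I0 by blast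
      show "\<exists>y. ((Suc j = 0 \<longrightarrow> y = r) \<and> (Suc j < ?n \<longrightarrow> I (Suc j) y)) \<and>
          (Suc j < ?n \<longrightarrow> bump (T' ! j) (T' ! Suc j) x y)"
        if "(j = 0 \<longrightarrow> x = r) \<and> (j < ?n \<longrightarrow> I j x)" for x j
        using that I_step[of j x] by (cases "Suc j < ?n") auto
    qed
    then show ?thesis using that by blast
  qed
  have "add_move m r (\<rho> (?n - 1)) T' T"
    unfolding box_move_def using tab tab' len len' \<rho> by (auto simp: I_def intro!: exI[of _ \<rho>])
  moreover have "\<forall>i < \<rho> (?n - 1). last T' ! i = last P ! i"
    using \<rho>(2)[of "?n - 1"] n len' by (cases "P = []"; cases "T' = []") (auto simp: I_def last_conv_nth)
  ultimately show ?thesis using T'(1) by blast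
qed

text \<open>Makes a sorted list of start rows recoverable from the two inner borders, and a sorted
  list of end rows from the two outer borders.\<close>

lemma move_path_borders:
  assumes "move_path (add_move m) rs rs' P T" "is_tableau m P"
  shows "is_tableau m T \<and> set rs \<subseteq> {..<m} \<and> set rs' \<subseteq> {..<m} \<and>
    (\<forall>i < m. hd T ! i = hd P ! i + int (count_list rs i) \<and> last T ! i = last P ! i + int (count_list rs' i))"
  using assms
proof (induction rule: move_path.induct)
  case (Nil P)
  then show ?case by simp
next
  case (snoc rs rs' P X r r' T)
  have "length (hd X) = m" "length (last X) = m"
    using snoc by (auto simp: is_tableau_def is_shape_length)
  then show ?case
    using snoc box_move_borders[OF snoc.hyps(2)] by (auto simp: nth_shift_row)
qed

text \<open>
  The order matters: inserting the boxes of a strip from the top row downwards can give a different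
  tableau. That the boxes added to the outer border come in the same order makes their rows
  recoverable from the two outer borders, as needed for reverse insertion.
\<close>

lemma strip_insert_path:
  assumes "strip_insert m P T"
  shows "\<exists>rs rs'. move_path (add_move m) rs rs' P T \<and> sorted_wrt (\<ge>) rs \<and> sorted_wrt (\<ge>) rs'"
  using assms
\<comment> \<open>Induction on the number of boxes of the inserted strip.\<close>
proof (induction "nat (\<Sum>i<m. T ! 0 ! i - P ! 0 ! i)" arbitrary: T rule: less_induct)
  case less
  have ne: "P \<noteq> []" "T \<noteq> []" and tab: "is_tableau m P" and strip0: "shape_strip m (P ! 0) (T ! 0)"
    using less.prems by (auto simp: strip_insert_def is_tableau_def)
  show ?case
  proof (cases "T ! 0 = P ! 0")
    case True
    then have "T = P" using strip_insert_unique[OF less.prems strip_insert_refl[OF tab]] by simp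
    then show ?thesis using move_path.Nil by fastforce
  next
    case False
    have lo: "P ! 0 ! i \<le> T ! 0 ! i" if "i < m" for i using strip0 that by (simp add: shape_strip_iff_nth)
    have "length (T ! 0) = m" "length (P ! 0) = m" using strip0 by (auto simp: shape_strip_iff_nth)
    then have "\<exists>i. i < m \<and> P ! 0 ! i < T ! 0 ! i"
      using False lo nth_equalityI[of "T ! 0" "P ! 0"] by (metis order_le_less)
    then obtain r where r: "r < m" "P ! 0 ! r < T ! 0 ! r"
      "\<And>i. i < r \<Longrightarrow> \<not> (i < m \<and> P ! 0 ! i < T ! 0 ! i)"
      using exists_least_iff[of "\<lambda>i. i < m \<and> P ! 0 ! i < T ! 0 ! i"] by blast
    have top: "T ! 0 ! i = P ! 0 ! i" if "i < r" for i
      using r(1) r(3)[OF that] lo[of i] that by simp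
    obtain T' r' where T': "strip_insert m P T'" "add_move m r r' T' T"
      "\<And>i. i < r' \<Longrightarrow> last T' ! i = last P ! i"
      using strip_insert_last_box[OF less.prems r(1,2) top] by blast
    have ne': "T' \<noteq> []" and strip': "shape_strip m (P ! 0) (T' ! 0)"
      using T'(1) ne by (auto simp: strip_insert_def is_tableau_def)
    have T0: "T ! 0 ! i = T' ! 0 ! i + (if i = r then 1 else 0)" if "i < m" for i
      using box_move_borders(1)[OF T'(2)] ne ne' strip' that
      by (auto simp: hd_conv_nth nth_shift_row shape_strip_iff_nth)
    have "(\<Sum>i<m. T ! 0 ! i - P ! 0 ! i) = (\<Sum>i<m. (T' ! 0 ! i - P ! 0 ! i) + (if i = r then 1 else 0))"
      by (rule sum.cong) (auto simp: T0)
    also have "\<dots> = (\<Sum>i<m. T' ! 0 ! i - P ! 0 ! i) + 1"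
      using r(1) by (simp add: sum.distrib)
    finally have "(\<Sum>i<m. T ! 0 ! i - P ! 0 ! i) = (\<Sum>i<m. T' ! 0 ! i - P ! 0 ! i) + 1" .
    moreover have "0 \<le> (\<Sum>i<m. T' ! 0 ! i - P ! 0 ! i)"
      using strip' by (intro sum_nonneg) (auto simp: shape_strip_iff_nth)
    ultimately obtain rs rs' where path: "move_path (add_move m) rs rs' P T'"
      and sorted: "sorted_wrt (\<ge>) rs" "sorted_wrt (\<ge>) rs'"
      using less.hyps[OF _ T'(1)] by auto
    \<comment> \<open>Rows above \<open>r\<close> gain no box on the way to \<open>T'\<close>, so
      \<open>r\<close> continues the weakly decreasing list. For end rows the same follows from the
      last clause of \<open>strip_insert_last_box\<close>.\<close>
    have "r \<le> x" if "x \<in> set rs" for x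
    proof (rule ccontr)
      assume "\<not> r \<le> x"
      then have "x < m" "T' ! 0 ! x = P ! 0 ! x" using T0[of x] top[of x] r(1) by auto
      then have "count_list rs x = 0"
        using move_path_borders[OF path tab] ne ne' by (simp add: hd_conv_nth)
      then show False using that by (simp add: count_list_0_iff)
    qed
    moreover have "r' \<le> x" if "x \<in> set rs'" for x
    proof (rule ccontr)
      assume "\<not> r' \<le> x"
      then have "x < m" "last T' ! x = last P ! x" using T'(3) box_move_borders(4)[OF T'(2)] by auto
      then have "count_list rs' x = 0" using move_path_borders[OF path tab] by simp
      then show False using that by (simp add: count_list_0_iff)
    qed
    ultimately have "sorted_wrt (\<ge>) (rs @ [r])" "sorted_wrt (\<ge>) (rs' @ [r'])"
      using sorted by (auto simp: sorted_wrt_append)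
    then show ?thesis using move_path.snoc[of "add_move m", OF path T'(2)] by blast
  qed
qed

lemma sorted_count_list_unique:
  fixes xs ys :: "'a :: linorder list"
  assumes "sorted_wrt (\<ge>) xs" "sorted_wrt (\<ge>) ys" "\<And>x. count_list xs x = count_list ys x"
  shows "xs = ys"
  using assms
proof (induction xs arbitrary: ys)
  case Nil
  then have "set ys = {}" by (metis count_list.simps(1) count_list_0_iff equals0I)
  then show ?case by simp
next
  case (Cons x xs)
  have sets: "set ys = set (x # xs)" using Cons.prems(3) by (metis count_list_0_iff subsetI subset_antisym)
  then obtain y ys' where ys: "ys = y # ys'" by (cases ys) auto
  have "y \<in> set (x # xs)" "x \<in> set ys" using sets ys by auto
  then have "y \<le> x" "x \<le> y" using Cons.prems(1,2) ys by auto
  then have "x = y" by simp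
  moreover have "count_list xs z = count_list ys' z" for z
    using Cons.prems(3)[of z] ys \<open>x = y\<close> by (auto split: if_splits)
  ultimately show ?case using Cons ys by auto
qed


section \<open>Slides\<close>

lemma jdt_unique: "jdt c f e g \<Longrightarrow> jdt c f e' g' \<Longrightarrow> e = e' \<and> g = g'"
proof (induction arbitrary: e' g' rule: jdt.induct)
  case (stop f i j)
  from stop(3) show ?case by cases (use stop(1,2) in auto)
next
  case (right f i j x e g)
  note hyps = right.hyps and IH = right.IH
  from right.prems show ?case
  proof cases
    case (right x')
    then have "x' = x" using hyps by simp
    with right IH show ?thesis by blast
  next
    case (down y)
    then show ?thesis using hyps by fastforce
  qed (use hyps in simp)
next
  case (down f i j y e g)
  note hyps = down.hyps and IH = down.IH
  from down.prems show ?case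
  proof cases
    case (right x)
    then show ?thesis using hyps by fastforce
  next
    case (down y')
    then have "y' = y" using hyps by simp
    with down IH show ?thesis by blast
  qed (use hyps in simp)
qed

section \<open>Chains of shapes and their fillings\<close>

lemma tableau_mono:
  assumes "is_tableau m P" "i < m" "k \<le> l" "l < length P"
  shows "P ! k ! i \<le> P ! l ! i"
  using assms(3,4)
proof (induction l rule: dec_induct)
  case (step l)
  then have "P ! l ! i \<le> P ! Suc l ! i"
    using is_tableau_nth_strip[OF assms(1), of l] assms(2) by (simp add: shape_strip_iff_nth)
  then show ?case using step by simp
qed simp

lemma tableau_borders:
  assumes "is_tableau m P" "k < length P" "i < m"
  shows "hd P ! i \<le> P ! k ! i" "P ! k ! i \<le> last P ! i"
  using tableau_mono[OF assms(1,3), of 0 k] tableau_mono[OF assms(1,3), of k "length P - 1"] assms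
  by (auto simp: is_tableau_def hd_conv_nth last_conv_nth)

lemma tableau_border_lengths:
  "is_tableau m P \<Longrightarrow> length (hd P) = m" "is_tableau m P \<Longrightarrow> length (last P) = m"
  by (auto simp: is_tableau_def is_shape_length)

lemma filling_of_None:
  "is_tableau m P \<Longrightarrow> \<not> (i < m \<and> hd P ! i < x \<and> x \<le> last P ! i) \<Longrightarrow> filling_of P (i, x) = None"
  using tableau_border_lengths(1)[of m P] by (auto simp: filling_of_def)

lemma filling_of_Suc:
  assumes "is_tableau m P" "i < m" "Suc k < length P" "P ! k ! i < x" "x \<le> P ! Suc k ! i"
  shows "filling_of P (i, x) = Some (Suc k)"
proof -
  have "hd P ! i < x" "x \<le> last P ! i"
    using tableau_borders(1)[OF assms(1) _ assms(2), of k] tableau_borders(2)[OF assms(1,3,2)] assms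
    by auto
  moreover have "(LEAST k. x \<le> P ! k ! i) = Suc k"
  proof (rule Least_equality)
    fix y assume y: "x \<le> P ! y ! i"
    show "Suc k \<le> y"
    proof (rule ccontr)
      assume "\<not> Suc k \<le> y"
      then have "P ! y ! i \<le> P ! k ! i" using assms by (intro tableau_mono[of m]) auto
      then show False using y assms by simp
    qed
  qed (rule assms)
  ultimately show ?thesis
    using assms tableau_border_lengths(1)[OF assms(1)] by (simp add: filling_of_def)
qed

lemma filling_of_Some:
  assumes "is_tableau m P" "filling_of P (i, x) = Some y"
  shows "i < m" "hd P ! i < x" "x \<le> last P ! i" "y < length P" "x \<le> P ! y ! i"
    and "\<And>k. k < length P \<Longrightarrow> P ! k ! i < x \<longleftrightarrow> k < y"
proof -
  show i: "i < m" and x: "hd P ! i < x" "x \<le> last P ! i"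
    using assms(2) tableau_border_lengths(1)[OF assms(1)]
    by (auto simp: filling_of_def split: if_splits)
  have y: "y = (LEAST k. x \<le> P ! k ! i)"
    using assms(2) by (auto simp: filling_of_def split: if_splits)
  have ne: "P \<noteq> []" using assms(1) by (simp add: is_tableau_def)
  then have *: "x \<le> P ! (length P - 1) ! i" using x by (simp add: last_conv_nth)
  show "x \<le> P ! y ! i" unfolding y using * by (rule LeastI)
  moreover have "y \<le> length P - 1" unfolding y using * by (rule Least_le)
  then show "y < length P" using ne by (cases P) auto
  ultimately show "P ! k ! i < x \<longleftrightarrow> k < y" if "k < length P" for k
    using that tableau_mono[OF assms(1) i, of y k] not_less_Least[of k "\<lambda>k. x \<le> P ! k ! i"] y
    by (cases "k < y") auto
qed

lemma filling_of_le_iff: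
  assumes "is_tableau m P" "i < m" "k < length P"
  shows "x \<le> P ! k ! i \<longleftrightarrow> x \<le> hd P ! i \<or> (\<exists>y. filling_of P (i, x) = Some y \<and> y \<le> k)"
proof
  assume "x \<le> P ! k ! i"
  moreover from this have "filling_of P (i, x) = Some (LEAST k. x \<le> P ! k ! i)" if "\<not> x \<le> hd P ! i"
    using that tableau_borders(2)[OF assms(1,3,2)] tableau_border_lengths(1)[OF assms(1)] assms(2)
    by (simp add: filling_of_def)
  ultimately show "x \<le> hd P ! i \<or> (\<exists>y. filling_of P (i, x) = Some y \<and> y \<le> k)"
    using Least_le[of "\<lambda>k. x \<le> P ! k ! i" k] by blast
next
  assume "x \<le> hd P ! i \<or> (\<exists>y. filling_of P (i, x) = Some y \<and> y \<le> k)"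
  then show "x \<le> P ! k ! i"
    using tableau_borders(1)[OF assms(1,3,2)] filling_of_Some(6)[OF assms(1) _ assms(3)]
    by (meson linorder_not_less order_trans)
qed

text \<open>By \<open>filling_of_le_iff\<close>, \<open>P ! k ! i\<close> is the last column
  satisfying a condition on the filling and the inner border. Lengths are compared separately
  because empty steps at the end of a chain leave no entries.\<close>

lemma filling_of_inject:
  assumes "is_tableau m P" "is_tableau m T" "length P = length T" "hd P = hd T"
    "filling_of P = filling_of T"
  shows "P = T"
proof (rule nth_equalityI)
  fix k assume k: "k < length P"
  show "P ! k = T ! k"
  proof (rule nth_equalityI)
    have len: "length (P ! k) = m" "length (T ! k) = m"
      using assms k is_tableau_nth_shape is_shape_length by metis+
    then show "length (P ! k) = length (T ! k)" by simp
    fix i assume "i < length (P ! k)"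
    then have "x \<le> P ! k ! i \<longleftrightarrow> x \<le> T ! k ! i" for x
      using filling_of_le_iff[OF assms(1), of i k x] filling_of_le_iff[OF assms(2), of i k x] assms k len
      by simp
    then show "P ! k ! i = T ! k ! i" by (meson order_antisym order_refl)
  qed
qed (rule assms)

section \<open>Slides as changes of one row in each shape\<close>

lemma descend_strip:
  assumes strip: "shape_strip m \<alpha> \<beta>" and r: "r < m" and shape: "is_shape m (shift_row (- 1) r \<alpha>)"
    and desc: "descend m \<alpha> \<beta> r r'"
  shows "r' < m" "shape_strip m (shift_row (- 1) r \<alpha>) (shift_row (- 1) r' \<beta>)"
proof -
  have len: "length \<alpha> = m" "length \<beta> = m"
    and lo: "\<And>x. x < m \<Longrightarrow> \<alpha> ! x \<le> \<beta> ! x" and hi: "\<And>x. Suc x < m \<Longrightarrow> \<beta> ! Suc x \<le> \<alpha> ! x"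
    using strip by (auto simp: shape_strip_iff_nth)
  show "r' < m" using desc r by (auto simp: descend_def split: if_splits)
  have strict: "\<alpha> ! r' < \<beta> ! r'" if "r \<noteq> r'"
    using that desc shape_shift_row_down[OF shape] by (auto simp: descend_def split: if_splits)
  have free: "\<beta> ! Suc r < \<alpha> ! r" if "Suc r \<noteq> r'" "Suc r < m"
    using that desc hi[of r] by (auto simp: descend_def split: if_splits)
  have "shift_row (- 1) r \<alpha> ! x \<le> shift_row (- 1) r' \<beta> ! x" if "x < m" for x
    using that lo[OF that] strict
    by (cases "x = r"; cases "x = r'") (auto simp: nth_shift_row len)
  moreover have "shift_row (- 1) r' \<beta> ! Suc x \<le> shift_row (- 1) r \<alpha> ! x" if "Suc x < m" for x
    using that hi[OF that] free
    by (cases "x = r"; cases "Suc x = r'") (auto simp: nth_shift_row len)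
  ultimately show "shape_strip m (shift_row (- 1) r \<alpha>) (shift_row (- 1) r' \<beta>)"
    by (simp add: shape_strip_iff_nth len)
qed

text \<open>\<open>descend\<close> determines the next row, so the rows are computed by recursion
  along the chain; \<open>descend_strip\<close> keeps the lowered shapes weakly decreasing and
  interlacing.\<close>

lemma remove_move_exists:
  assumes P: "is_tableau m P" and r: "r < m" and shape: "is_shape m (shift_row (- 1) r (hd P))"
  shows "\<exists>r' T. remove_move m r r' P T"
proof -
  define \<rho> where "\<rho> = rec_nat r (\<lambda>j q. if Suc q < m \<and> P ! Suc j ! Suc q = P ! j ! q then Suc q else q)"
  let ?S = "\<lambda>j. shift_row (- 1) (\<rho> j) (P ! j)"
  have ne: "P \<noteq> []" using P by (simp add: is_tableau_def)
  have desc: "descend m (P ! j) (P ! Suc j) (\<rho> j) (\<rho> (Suc j))" for j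
    by (simp add: \<rho>_def descend_def)
  have inv: "j < length P \<Longrightarrow> \<rho> j < m \<and> is_shape m (?S j)" for j
  proof (induction j)
    case 0
    then show ?case using r shape ne by (simp add: \<rho>_def hd_conv_nth)
  next
    case (Suc j)
    then show ?case
      using descend_strip[OF is_tableau_nth_strip[OF P] _ _ desc, of j]
      by (simp add: shape_strip_def)
  qed
  have tab: "is_tableau m (map ?S [0..<length P])"
    using ne inv by (intro is_tableau_mapI)
      (auto intro: descend_strip(2)[OF is_tableau_nth_strip[OF P] _ _ desc])
  have "remove_move m (\<rho> 0) (\<rho> (length P - 1)) (map ((!) P) [0..<length P]) (map ?S [0..<length P])"
    using ne tab P inv desc by (intro box_move_mapI) (auto simp: map_nth)
  moreover have "\<rho> 0 = r" by (simp add: \<rho>_def)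
  ultimately show ?thesis by (auto simp: map_nth)
qed

text \<open>
  A slide passes through the strips one after the other. When it has passed through the first
  \<open>j\<close> strips, the boxes of \<open>P ! j\<close> already carry the entries of the result.
\<close>

lemma remove_move_jdt:
  assumes "remove_move m r r' P T"
  shows "jdt (r, hd P ! r) (filling_of P) (r', last P ! r') (filling_of T)"
proof -
  let ?n = "length P"
  obtain \<rho> where \<rho>: "\<rho> 0 = r" "\<rho> (?n - 1) = r'"
    "\<And>j. j < ?n \<Longrightarrow> \<rho> j < m" "\<And>j. j < ?n \<Longrightarrow> T ! j = shift_row (- 1) (\<rho> j) (P ! j)"
    "\<And>j. Suc j < ?n \<Longrightarrow> descend m (P ! j) (P ! Suc j) (\<rho> j) (\<rho> (Suc j))"
    and P: "is_tableau m P" and T: "is_tableau m T" and len: "length T = ?n"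
    using assms by (auto simp: box_move_def)
  have n: "0 < ?n" "P \<noteq> []" "T \<noteq> []" using P T by (auto simp: is_tableau_def)
  have T_nth: "T ! j ! i = (if i = \<rho> j then P ! j ! i - 1 else P ! j ! i)" if "j < ?n" "i < m" for i j
    using that \<rho>(4) is_tableau_nth_shape[OF P, of j] by (simp add: nth_shift_row is_shape_length)
  have corner: "P ! j ! Suc (\<rho> j) < P ! j ! \<rho> j" if "j < ?n" "Suc (\<rho> j) < m" for j
    using that shape_shift_row_down[of m "\<rho> j" "P ! j"] is_tableau_nth_shape[OF T, of j] len \<rho>(4)
    by simp
  \<comment> \<open>The result inside \<open>T ! j\<close>, the original filling outside
    \<open>P ! j\<close>, and the hole in the single box between them.\<close>
  define F where "F j = (\<lambda>(i, x). if i < m \<and> x \<le> P ! j ! i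
      then if x \<le> T ! j ! i then filling_of T (i, x) else None else filling_of P (i, x))" for j
  let ?e = "(r', last P ! r')"
  have F_first: "F 0 = filling_of P"
    using n T_nth[of 0] filling_of_None[OF P] filling_of_None[OF T]
    by (auto simp: F_def fun_eq_iff hd_conv_nth)
  have F_last: "F (?n - 1) = filling_of T"
  proof -
    have last: "P ! (?n - 1) = last P" "T ! (?n - 1) = last T"
      using n len by (simp_all add: last_conv_nth)
    have le: "last T ! i \<le> last P ! i" if "i < m" for i
      using that T_nth[of "?n - 1" i] n last by (auto split: if_splits)
    have "F (?n - 1) (i, x) = filling_of T (i, x)" for i x
      using le[of i] filling_of_None[OF P, of i x] filling_of_None[OF T, of i x]
      unfolding F_def last by (cases "i < m"; cases "x \<le> last T ! i"; cases "x \<le> last P ! i") auto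
    then show ?thesis by auto
  qed
  have entry: "filling_of P (i, x) = Some (Suc j)"
    if "Suc j < ?n" "i < m" "P ! j ! i < x" "x \<le> P ! Suc j ! i" for i j x
    using filling_of_Suc[OF P] that by blast
  have entry': "filling_of T (i, x) = Some (Suc j)"
    if "Suc j < ?n" "i < m" "T ! j ! i < x" "x \<le> T ! Suc j ! i" for i j x
    using filling_of_Suc[OF T] that len by auto
  \<comment> \<open>Proved backwards along the chain, because the rules of \<open>jdt\<close>
    prepend a move to a run that ends at \<open>?e\<close>.\<close>
  have main: "jdt (\<rho> j, P ! j ! \<rho> j) (F j) ?e (filling_of T)" if "j < ?n" for j
    using that
  proof (induction "?n - Suc j" arbitrary: j)
    case 0
    then have j: "j = ?n - 1" by simp
    have "filling_of T (r', last P ! r' + 1) = None" "filling_of T (Suc r', last P ! r') = None"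
    proof -
      have lastT: "last T ! i = (if i = r' then last P ! i - 1 else last P ! i)" if "i < m" for i
        using that T_nth[of "?n - 1" i] n len \<rho>(2) by (simp add: last_conv_nth)
      have "last P ! Suc r' < last P ! r'" if "Suc r' < m"
        using that corner[of "?n - 1"] n \<rho>(2) by (simp add: last_conv_nth)
      then show "filling_of T (r', last P ! r' + 1) = None" "filling_of T (Suc r', last P ! r') = None"
        using lastT by (auto intro!: filling_of_None[OF T])
    qed
    then show ?case
      using F_last n \<rho>(2) unfolding j by (simp add: last_conv_nth jdt.stop)
  next
    case (Suc l)
    then have j: "Suc j < ?n" "j < ?n" by auto
    define q c where "q = \<rho> j" and "c = P ! j ! q"
    have q: "q < m" "descend m (P ! j) (P ! Suc j) q (\<rho> (Suc j))"
      using \<rho>(3,5) j by (simp_all add: q_def)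
    have IH: "jdt (\<rho> (Suc j), P ! Suc j ! \<rho> (Suc j)) (F (Suc j)) ?e (filling_of T)"
      using Suc by simp
    have strips: "P ! j ! i \<le> P ! Suc j ! i" "Suc i < m \<Longrightarrow> P ! Suc j ! Suc i \<le> P ! j ! i"
      "T ! j ! i \<le> T ! Suc j ! i" if "i < m" for i
      using is_tableau_nth_strip[OF P j(1)] is_tableau_nth_strip[OF T, of j] j(1) len that
      by (auto simp: shape_strip_iff_nth)
    have F_j: "F j (i, x) = (if x \<le> T ! j ! i then filling_of T (i, x) else if x \<le> P ! j ! i then None
        else if x \<le> P ! Suc j ! i then Some (Suc j) else filling_of P (i, x))" if "i < m" for i x
      using that T_nth[of j i] j entry[of j i x] by (auto simp: F_def)
    have F_Suc: "F (Suc j) (i, x) = (if x \<le> T ! j ! i then filling_of T (i, x)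
        else if x \<le> T ! Suc j ! i then Some (Suc j) else if x \<le> P ! Suc j ! i then None
        else filling_of P (i, x))" if "i < m" for i x
      using that T_nth[of "Suc j" i] j entry'[of j i x] strips[of i] by (auto simp: F_def)
    have F_out: "F j' (i, x) = None" if "\<not> i < m" for j' i x
      using that filling_of_None[OF P] by (simp add: F_def)
    have Tq: "T ! j ! q = c - 1" using T_nth[OF j(2) q(1)] by (simp add: q_def c_def)
    show ?case
    proof (cases "\<rho> (Suc j) = q")
      case True
      have free: "P ! Suc j ! Suc q < c" if "Suc q < m"
        using that True q strips(2)[of q] by (auto simp: descend_def c_def split: if_splits)
      \<comment> \<open>The hole runs to the right through the boxes of row \<open>q\<close> with
        entry \<open>Suc j\<close>; \<open>H y\<close> is the filling when it has reached column
        \<open>y\<close>.\<close>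
      define H where "H y = (\<lambda>(i, x). if i = q \<and> c \<le> x \<and> x < y then Some (Suc j)
          else if i = q \<and> x = y then None else F j (i, x))" for y
      have H_first: "H c = F j"
        using q F_j[of q c] Tq by (auto simp: H_def fun_eq_iff c_def)
      have H_last: "H (P ! Suc j ! q) = F (Suc j)"
      proof
        fix b :: box
        obtain i x where b: "b = (i, x)" by fastforce
        show "H (P ! Suc j ! q) b = F (Suc j) b"
        proof (cases "i < m")
          case False
          then show ?thesis using q by (simp add: b H_def F_out)
        next
          case i: True
          show ?thesis
            unfolding b H_def prod.case F_j[OF i, of x] F_Suc[OF i, of x]
            using T_nth[OF j(2) i] T_nth[OF j(1) i] strips(1)[OF i] True
            by (auto simp: c_def q_def)
        qed
      qed
      have "c \<le> y \<longrightarrow> jdt (q, y) (H y) ?e (filling_of T)" if "y \<le> P ! Suc j ! q" for y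
        using that
      proof (induction y rule: int_le_induct)
        case base
        then show ?case using IH True H_last by simp
      next
        case (step y)
        show ?case
        proof
          assume y: "c \<le> y - 1"
          have "H (y - 1) (q, (y - 1) + 1) = Some (Suc j)"
            using y step.hyps q F_j[of q y] Tq by (simp add: H_def c_def)
          \<comment> \<open>By \<open>free\<close> the box below the hole lies outside
            \<open>P ! Suc j\<close>, so its entry, if any, exceeds \<open>Suc j\<close> and the
            hole moves right.\<close>
          moreover have "Suc j < z" if z: "H (y - 1) (Suc q, y - 1) = Some z" for z
          proof -
            have Fz: "F j (Suc q, y - 1) = Some z" using z by (simp add: H_def)
            then have Sq: "Suc q < m" using F_out by (metis option.distinct(1))
            then have "P ! Suc j ! Suc q < y - 1" using free y by simp
            moreover from this have "P ! j ! Suc q < y - 1" using strips(1)[OF Sq] by simp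
            ultimately have "filling_of P (Suc q, y - 1) = Some z" using Fz by (simp add: F_def)
            then show ?thesis
              using filling_of_Some(6)[OF P, of "Suc q" "y - 1" z "Suc j"] j
                \<open>P ! Suc j ! Suc q < y - 1\<close> by simp
          qed
          moreover have "(H (y - 1))((q, y - 1) := Some (Suc j), (q, (y - 1) + 1) := None) = H y"
            using y by (auto simp: H_def fun_eq_iff)
          moreover have "jdt (q, (y - 1) + 1) (H y) ?e (filling_of T)" using step.IH y by simp
          ultimately show "jdt (q, y - 1) (H (y - 1)) ?e (filling_of T)"
            using jdt.right[of "H (y - 1)" q "y - 1" "Suc j" ?e "filling_of T"] by metis
        qed
      qed
      from this[of c] show ?thesis using strips(1)[OF q(1)] H_first by (simp add: c_def q_def)
    next
      case False
      then have down: "\<rho> (Suc j) = Suc q" "Suc q < m" "P ! Suc j ! Suc q = c"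
        using q by (auto simp: descend_def c_def split: if_splits)
      \<comment> \<open>The box below the hole ends its row in \<open>P ! Suc j\<close> and has
        entry \<open>Suc j\<close>. The right neighbour lies outside \<open>P ! j\<close>, so its
        entry is not smaller, and a tie goes to the lower neighbour.\<close>
      have Pq: "P ! j ! Suc q < c" using corner[OF j(2)] down by (simp add: q_def c_def)
      have "F j (Suc q, c) = Some (Suc j)"
        using F_j[OF down(2), of c] T_nth[OF j(2) down(2)] Pq down by (simp add: q_def)
      moreover have "Suc j \<le> x" if "F j (q, c + 1) = Some x" for x
      proof -
        have "filling_of P (q, c + 1) = Some x" using that by (simp add: F_def c_def)
        then show ?thesis using filling_of_Some(6)[OF P, of q "c + 1" x j] j by (simp add: c_def)
      qed
      moreover have "(F j)((q, c) := Some (Suc j), (Suc q, c) := None) = F (Suc j)"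
      proof
        fix b :: box
        obtain i x where b: "b = (i, x)" by fastforce
        show "((F j)((q, c) := Some (Suc j), (Suc q, c) := None)) b = F (Suc j) b"
        proof (cases "i < m")
          case False
          then show ?thesis using q down by (auto simp: b F_out)
        next
          case i: True
          show ?thesis
            unfolding b fun_upd_apply F_j[OF i, of x] F_Suc[OF i, of x]
            using T_nth[OF j(2) i] T_nth[OF j(1) i] strips(1)[OF i] down Pq
            by (auto simp: c_def q_def)
        qed
      qed
      ultimately have "jdt (q, c) (F j) ?e (filling_of T)"
        using jdt.down[of "F j" q c "Suc j" ?e "filling_of T"] IH down by metis
      then show ?thesis by (simp add: q_def c_def)
    qed
  qed
  from main[of 0] show ?thesis using n \<rho>(1) F_first by (simp add: hd_conv_nth)
qed

lemma remove_move_slide: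
  assumes "remove_move m r r' P T"
  shows "slide m (r, hd P ! r) (r', last P ! r') P T"
proof -
  note b = box_move_borders[OF assms]
  have len: "length (hd P) = m" using tableau_border_lengths b by blast
  have "is_shape m (hd T)" using b(6) by (simp add: is_tableau_def)
  then have "Suc r < m \<Longrightarrow> hd P ! Suc r < hd P ! r"
    using shape_shift_row_down b(1) by simp
  then show ?thesis
    using b len remove_move_jdt[OF assms]
    by (simp add: slide_def inner_corner_def remove_box_def shift_row_def)
qed

text \<open>By determinism of \<open>jdt\<close>: the move built from the same corner by
  \<open>remove_move_exists\<close> has the same end and the same resulting filling, which together
  with the inner border determines the chain.\<close>

lemma slide_remove_move:
  assumes "slide m c e P T"
  shows "remove_move m (fst c) (fst e) P T"
proof -
  have P: "is_tableau m P" "is_tableau m T" "length T = length P"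
    and c: "inner_corner (hd P) c" and jdt: "jdt c (filling_of P) e (filling_of T)"
    and hdT: "hd T = remove_box c (hd P)"
    using assms by (auto simp: slide_def)
  have len: "length (hd P) = m" using tableau_border_lengths P by blast
  have shift: "remove_box c (hd P) = shift_row (- 1) (fst c) (hd P)"
    using c by (simp add: remove_box_def shift_row_def inner_corner_def)
  have "fst c < m" using c len by (simp add: inner_corner_def)
  moreover have "is_shape m (shift_row (- 1) (fst c) (hd P))"
    using P(2) hdT shift by (metis is_tableau_def list.set_sel(1))
  ultimately obtain r' X where X: "remove_move m (fst c) r' P X"
    using remove_move_exists[OF P(1)] by blast
  have "jdt c (filling_of P) (r', last P ! r') (filling_of X)"
    using remove_move_jdt[OF X] c by (cases c) (simp add: inner_corner_def)
  then have "e = (r', last P ! r')" "filling_of T = filling_of X"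
    using jdt_unique[OF jdt] by auto
  moreover have "T = X"
    using calculation(2) P box_move_borders[OF X] hdT shift
    by (intro filling_of_inject[of m]) auto
  ultimately show ?thesis using X by simp
qed


section \<open>The two dual equivalences\<close>

text \<open>The opposite ends \<open>a\<close> and \<open>b\<close> are unrelated in each clause.
  Both clauses are used in every simulation, which goes forwards to the translates and backwards
  from there.\<close>

definition closed_under ::
    "(nat \<Rightarrow> nat \<Rightarrow> tableau \<Rightarrow> tableau \<Rightarrow> bool) \<Rightarrow> (tableau \<Rightarrow> tableau \<Rightarrow> bool) \<Rightarrow> bool" where
  "closed_under R E \<longleftrightarrow>
     (\<forall>r a b P P' T T'. R r a P T \<longrightarrow> R r b P' T' \<longrightarrow> E P P' \<longrightarrow> E T T') \<and>
     (\<forall>r a b P P' T T'. R a r P T \<longrightarrow> R b r P' T' \<longrightarrow> E T T' \<longrightarrow> E P P')"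

lemma closed_under_path:
  assumes "closed_under R E"
  shows "move_path R rs a P T \<Longrightarrow> move_path R rs b P' T' \<Longrightarrow> E P P' \<Longrightarrow> E T T'"
    and "move_path R a rs P T \<Longrightarrow> move_path R b rs P' T' \<Longrightarrow> E T T' \<Longrightarrow> E P P'"
  using move_path_relate[of R rs a P T b P' T' E] move_path_relate_back[of R a rs P T b P' T' E]
    assms[unfolded closed_under_def] by blast+

text \<open>From \<open>E P P'\<close> the simulating slides lead forwards to the translates, and
  the translating slides are followed back to \<open>T\<close> and \<open>T'\<close>. The second
  clause runs the other way and uses that the end rows of the simulating slides depend only on
  \<open>r\<close>.\<close>

lemma closed_under_add_move:
  assumes "closed_under (remove_move m) E"
  shows "closed_under (add_move m) E"
  unfolding closed_under_def
proof (intro conjI allI impI)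
  fix r a b P P' T T'
  assume "add_move m r a P T" "add_move m r b P' T'" "E P P'"
  then show "E T T'"
    using add_move_by_remove_moves[of m r a P T] add_move_by_remove_moves[of m r b P' T']
      closed_under_path[OF assms] by blast
next
  fix r a b P P' T T'
  assume "add_move m a r P T" "add_move m b r P' T'" "E T T'"
  then show "E P P'"
    using add_move_by_remove_moves[of m a r P T] add_move_by_remove_moves[of m b r P' T']
      closed_under_path[OF assms] by blast
qed

lemma closed_under_remove_move:
  assumes "closed_under (add_move m) E"
  shows "closed_under (remove_move m) E"
  unfolding closed_under_def
proof (intro conjI allI impI)
  fix r a b P P' T T'
  assume "remove_move m r a P T" "remove_move m r b P' T'" "E P P'"
  then show "E T T'"
    using remove_move_by_add_moves[of m r a P T] remove_move_by_add_moves[of m r b P' T']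
      closed_under_path[OF assms] by blast
next
  fix r a b P P' T T'
  assume "remove_move m a r P T" "remove_move m b r P' T'" "E T T'"
  then show "E P P'"
    using remove_move_by_add_moves[of m a r P T] remove_move_by_add_moves[of m b r P' T']
      closed_under_path[OF assms] by blast
qed

section \<open>Dual equivalence as a largest respected relation\<close>

lemma dual_equivalent_by_step:
  assumes "dual_equivalent_by step P P'" "step a P T" "step a P' T'"
  shows "dual_equivalent_by step T T'"
proof -
  have "same_shape X X'" if "steps step as T X" "steps step as T' X'" for as X X'
    using assms steps.Cons[of step a, OF assms(2) that(1)] steps.Cons[of step a, OF assms(3) that(2)]
    unfolding dual_equivalent_by_def by blast
  then show ?thesis unfolding dual_equivalent_by_def using steps.Nil by blast
qed

text \<open>A coinduction principle. With \<open>dual_equivalent_by_step\<close> it describes dual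
  equivalence as the largest relation that is respected by all moves and relates only tableaux of
  the same shape.\<close>

lemma dual_equivalent_byI:
  assumes closed: "\<And>a P P' T T'. step a P T \<Longrightarrow> step a P' T' \<Longrightarrow> E P P' \<Longrightarrow> E T T'"
    and shape: "\<And>P P'. E P P' \<Longrightarrow> same_shape P P'" and "E P P'"
  shows "dual_equivalent_by step P P'"
proof -
  have "E X X'" if "steps step as P X" "steps step as P' X'" "E P P'" for as P P' X X'
    using that
  proof (induction arbitrary: P' rule: steps.induct)
    case (Nil P)
    then show ?case by (auto elim: steps.cases)
  next
    case (Cons a P X as Y)
    from Cons.prems(1) obtain X1 where "step a P' X1" "steps step as X1 X'"
      by (auto elim: steps.cases)
    then show ?case using Cons closed by blast
  qed
  then show ?thesis using assms unfolding dual_equivalent_by_def by blast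
qed

lemma remove_move_slide_step:
  assumes "remove_move m r r' P T"
  shows "slide_step m (Slide (r, hd P ! r)) P T"
    and "slide_step m (Reverse_Slide (r', last T ! r' + 1)) T P"
proof -
  have "last P ! r' = last T ! r' + 1"
    using box_move_borders[OF assms] tableau_border_lengths(2)[of m P] by (simp add: nth_shift_row)
  then show "slide_step m (Slide (r, hd P ! r)) P T"
    "slide_step m (Reverse_Slide (r', last T ! r' + 1)) T P"
    using remove_move_slide[OF assms] by auto
qed

text \<open>Slides are named by boxes, \<open>remove_move\<close> by rows. Dual equivalent tableaux
  have equal borders, so equal rows give equal boxes: the inner border locates the start of a slide,
  the outer border that of a reverse slide.\<close>

lemma dual_equivalent_closed: "closed_under (remove_move m) (dual_equivalent m)"
  unfolding closed_under_def
proof (intro conjI allI impI)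
  fix r a b P P' T T'
  assume *: "remove_move m r a P T" "remove_move m r b P' T'" and E: "dual_equivalent m P P'"
  then have "hd P = hd P'" by (simp add: dual_equivalent_def dual_equivalent_by_def same_shape_def)
  then show "dual_equivalent m T T'"
    using remove_move_slide_step(1)[OF *(1)] remove_move_slide_step(1)[OF *(2)] E
      dual_equivalent_by_step[of "slide_step m" P P'] by (simp add: dual_equivalent_def del: slide_step.simps)
next
  fix r a b P P' T T'
  assume *: "remove_move m a r P T" "remove_move m b r P' T'" and E: "dual_equivalent m T T'"
  then have "last T = last T'" by (simp add: dual_equivalent_def dual_equivalent_by_def same_shape_def)
  then show "dual_equivalent m P P'"
    using remove_move_slide_step(2)[OF *(1)] remove_move_slide_step(2)[OF *(2)] E
      dual_equivalent_by_step[of "slide_step m" T T'] by (simp add: dual_equivalent_def del: slide_step.simps)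
qed

lemma closed_under_slide_step:
  assumes "closed_under (remove_move m) E" "slide_step m a P T" "slide_step m a P' T'" "E P P'"
  shows "E T T'"
proof (cases a)
  case (Slide c)
  then obtain e e' where "remove_move m (fst c) e P T" "remove_move m (fst c) e' P' T'"
    using assms slide_remove_move by (metis slide_step.simps(1))
  then show ?thesis using assms(1,4) unfolding closed_under_def by blast
next
  case (Reverse_Slide e)
  then obtain c c' where "remove_move m c (fst e) T P" "remove_move m c' (fst e) T' P'"
    using assms slide_remove_move by (metis slide_step.simps(2))
  then show ?thesis using assms(1,4) unfolding closed_under_def by blast
qed

section \<open>Insertions of boxes and strips as insertion moves\<close>

lemma add_move_strip_insert:
  assumes "add_move m r r' P T"
  shows "strip_insert m P T"
proof -
  obtain \<rho> where \<rho>: "\<And>j. j < length P \<Longrightarrow> \<rho> j < m"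
    "\<And>j. j < length P \<Longrightarrow> T ! j = shift_row 1 (\<rho> j) (P ! j)"
    "\<And>j. Suc j < length P \<Longrightarrow> bump (P ! j) (P ! Suc j) (\<rho> j) (\<rho> (Suc j))"
    and tab: "is_tableau m P" "is_tableau m T" and len: "length T = length P"
    using assms by (auto simp: box_move_def)
  have "shape_strip m (P ! j) (T ! j)" if j: "j < length P" for j
  proof -
    have shape: "is_shape m (P ! j)" "is_shape m (shift_row 1 (\<rho> j) (P ! j))"
      using tab j len \<rho>(2)[OF j] is_tableau_nth_shape by metis+
    then have "shift_row 1 (\<rho> j) (P ! j) ! Suc i \<le> P ! j ! i" if "Suc i < m" for i
      using that shape_shift_row_up[of m i "P ! j"]
      by (cases "Suc i = \<rho> j") (auto simp: nth_shift_row is_shape_iff_nth)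
    then show ?thesis
      using shape \<rho>(2)[OF j] by (auto simp: shape_strip_iff_nth nth_shift_row is_shape_length)
  qed
  moreover have "T ! Suc j = local_rule (P ! j) (P ! Suc j) (T ! j)" if j: "Suc j < length P" for j
  proof -
    note strip = is_tableau_nth_strip[OF tab(1) j]
    have "shape_strip m (P ! j) (P ! j)"
      using strip horizontal_strip_refl by (auto simp: shape_strip_def)
    \<comment> \<open>The case \<open>\<gamma> = \<alpha>\<close> of \<open>local_rule_bump\<close>:
      nothing has been inserted before, and \<open>\<delta>\<close> is
      \<open>\<beta>\<close>.\<close>
    then show ?thesis
      using local_rule_bump(1)[OF strip, of "P ! j" "\<rho> j" "\<rho> (Suc j)"] \<rho> j
      by (simp add: local_rule_trivial[OF strip])
  qed
  ultimately show ?thesis using tab len by (simp add: strip_insert_def)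
qed

lemma strip_insert_growth:
  assumes "strip_insert m P T"
  obtains G where "growth m (length P - 1) 1 G"
    "growth_row G (length P - 1) 0 = P" "growth_row G (length P - 1) 1 = T"
    "growth_col G 1 0 = [hd P, hd T]" "growth_col G 1 (length P - 1) = [last P, last T]"
proof -
  define G where "G i = (!) (if i = 0 then P else T)" for i :: nat
  have tab: "is_tableau m P" "is_tableau m T" and len: "length T = length P"
    and strip: "\<And>j. j < length P \<Longrightarrow> shape_strip m (P ! j) (T ! j)"
    and rule: "\<And>j. Suc j < length P \<Longrightarrow> T ! Suc j = local_rule (P ! j) (P ! Suc j) (T ! j)"
    using assms by (auto simp: strip_insert_def)
  have ne: "P \<noteq> []" "T \<noteq> []" using tab by (auto simp: is_tableau_def)
  have "growth_square m (P ! j) (P ! Suc j) (T ! j) (T ! Suc j)" if j: "Suc j < length P" for j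
    using growth_square_local_rule[OF is_tableau_nth_strip[OF tab(1) j] strip] rule[OF j] j by simp
  moreover have "shape_strip m (P ! j) (T ! j)" if "j \<le> length P - Suc 0" for j
    using that ne strip by (cases P) auto
  ultimately have "growth m (length P - 1) 1 G"
    using tab ne len unfolding growth_def
    by (auto simp: G_def is_tableau_nth_shape intro: is_tableau_nth_strip)
  moreover have "growth_row G (length P - 1) 0 = P" "growth_row G (length P - 1) 1 = T"
    using ne len map_nth[of T] by (auto simp: growth_row_def G_def map_nth simp del: upt_Suc)
  moreover have "growth_col G 1 0 = [hd P, hd T]" "growth_col G 1 (length P - 1) = [last P, last T]"
    using ne len by (simp_all add: growth_col_def G_def hd_conv_nth last_conv_nth)
  ultimately show ?thesis using that by blast
qed

lemma strip_insert_insertion_step: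
  assumes "strip_insert m P T"
  shows "insertion_step m (Insert [hd P, hd T]) P T"
    and "insertion_step m (Reverse_Insert [last P, last T]) T P"
proof -
  obtain G where G: "growth m (length P - 1) 1 G"
    "growth_row G (length P - 1) 0 = P" "growth_row G (length P - 1) 1 = T"
    "growth_col G 1 0 = [hd P, hd T]" "growth_col G 1 (length P - 1) = [last P, last T]"
    using strip_insert_growth[OF assms] by blast
  show "insertion_step m (Insert [hd P, hd T]) P T"
    using growth_inner_pair[OF G(1)] column_insert_growth[OF G(1)] unfolding G by simp
  show "insertion_step m (Reverse_Insert [last P, last T]) T P"
    using growth_outer_pair[OF G(1)] reverse_column_insert_growth[OF G(1)] unfolding G by simp
qed

lemma C_dual_equivalent_closed: "closed_under (add_move m) (C_dual_equivalent m)"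
  unfolding closed_under_def
proof (intro conjI allI impI)
  fix r a b P P' T T'
  assume *: "add_move m r a P T" "add_move m r b P' T'" and E: "C_dual_equivalent m P P'"
  then have "hd P = hd P'" by (simp add: C_dual_equivalent_def dual_equivalent_by_def same_shape_def)
  moreover from this have "hd T = hd T'"
    using box_move_borders(1)[OF *(1)] box_move_borders(1)[OF *(2)] by simp
  ultimately show "C_dual_equivalent m T T'"
    using strip_insert_insertion_step(1)[OF add_move_strip_insert[OF *(1)]]
      strip_insert_insertion_step(1)[OF add_move_strip_insert[OF *(2)]] E
      dual_equivalent_by_step[of "insertion_step m" P P']
    by (simp add: C_dual_equivalent_def del: insertion_step.simps)
next
  fix r a b P P' T T'
  assume *: "add_move m a r P T" "add_move m b r P' T'" and E: "C_dual_equivalent m T T'"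
  then have T: "last T = last T'" by (simp add: C_dual_equivalent_def dual_equivalent_by_def same_shape_def)
  have "last P = shift_row (- 1) r (last T)" "last P' = shift_row (- 1) r (last T')"
    using box_move_borders[OF *(1)] box_move_borders[OF *(2)] tableau_border_lengths(2)
    by (simp_all add: shift_row_def)
  with T have "last P = last P'" by simp
  with T show "C_dual_equivalent m P P'"
    using strip_insert_insertion_step(2)[OF add_move_strip_insert[OF *(1)]]
      strip_insert_insertion_step(2)[OF add_move_strip_insert[OF *(2)]] E
      dual_equivalent_by_step[of "insertion_step m" T T']
    by (simp add: C_dual_equivalent_def del: insertion_step.simps)
qed

text \<open>The paths of \<open>strip_insert_path\<close> are sorted at both ends, so equal inner
  borders force equal start rows and equal outer borders equal end rows; then \<open>E\<close> is
  transported along the paths.\<close>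

lemma closed_under_strip_insert:
  assumes E: "closed_under (add_move m) E" and ins: "strip_insert m P T" "strip_insert m P' T'"
  shows "E P P' \<Longrightarrow> hd P = hd P' \<Longrightarrow> hd T = hd T' \<Longrightarrow> E T T'"
    and "E T T' \<Longrightarrow> last P = last P' \<Longrightarrow> last T = last T' \<Longrightarrow> E P P'"
proof -
  have tab: "is_tableau m P" "is_tableau m P'" using ins by (auto simp: strip_insert_def)
  obtain rs rs' qs qs' where path: "move_path (add_move m) rs rs' P T" "move_path (add_move m) qs qs' P' T'"
    and sorted: "sorted_wrt (\<ge>) rs" "sorted_wrt (\<ge>) rs'" "sorted_wrt (\<ge>) qs" "sorted_wrt (\<ge>) qs'"
    using strip_insert_path[OF ins(1)] strip_insert_path[OF ins(2)] by blast
  note borders = move_path_borders[OF path(1) tab(1)] move_path_borders[OF path(2) tab(2)]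
  have outside: "count_list rs i = 0" "count_list rs' i = 0" "count_list qs i = 0" "count_list qs' i = 0"
    if "\<not> i < m" for i
    using that borders by (auto simp: count_list_0_iff)
  show "E T T'" if "E P P'" "hd P = hd P'" "hd T = hd T'"
  proof -
    have "count_list rs i = count_list qs i" for i
      using that borders outside[of i] by (cases "i < m") force+
    then have "rs = qs" using sorted by (intro sorted_count_list_unique)
    then show ?thesis using closed_under_path(1)[OF E] path that by blast
  qed
  show "E P P'" if "E T T'" "last P = last P'" "last T = last T'"
  proof -
    have "count_list rs' i = count_list qs' i" for i
      using that borders outside[of i] by (cases "i < m") force+
    then have "rs' = qs'" using sorted by (intro sorted_count_list_unique)
    then show ?thesis using closed_under_path(2)[OF E] path that by blast
  qed
qed

text \<open>The two diagrams share the column \<open>Q\<close> or \<open>U\<close>, hence the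
  borders that fix each strip, but may differ in width. \<open>E\<close> is carried from row to row,
  upwards for reverse insertion.\<close>

lemma closed_under_insertion_step:
  assumes E: "closed_under (add_move m) E"
    and steps: "insertion_step m a P T" "insertion_step m a P' T'" and PP': "E P P'"
  shows "E T T'"
proof (cases a)
  case (Insert Q)
  define q where "q = length Q - 1"
  have pairs: "(P, Q) \<in> inner_pairs m" "(P', Q) \<in> inner_pairs m"
    using steps Insert by auto
  obtain G where G: "growth m (length P - 1) q G"
    "P = growth_row G (length P - 1) 0" "Q = growth_col G q 0"
    using inner_pair_growth[OF pairs(1)] unfolding q_def by blast
  obtain G' where G': "growth m (length P' - 1) q G'"
    "P' = growth_row G' (length P' - 1) 0" "Q = growth_col G' q 0"
    using inner_pair_growth[OF pairs(2)] unfolding q_def by blast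
  have first: "G i 0 = G' i 0" if "i \<le> q" for i
    using that G(3) G'(3) growth_col_simps(2) by metis
  have "i \<le> q \<Longrightarrow> E (growth_row G (length P - 1) i) (growth_row G' (length P' - 1) i)" for i
  proof (induction i)
    case 0
    then show ?case using PP' G(2) G'(2) by simp
  next
    case (Suc i)
    then show ?case
      using closed_under_strip_insert(1)[OF E growth_strip_insert[OF G(1)] growth_strip_insert[OF G'(1)], of i i]
        first by simp
  qed
  moreover have "T = growth_row G (length P - 1) q" "T' = growth_row G' (length P' - 1) q"
    using steps Insert column_insert_growth[OF G(1)] column_insert_growth[OF G'(1)] G(2,3) G'(2,3)
    by simp_all
  ultimately show ?thesis by simp
next
  case (Reverse_Insert U)
  define q where "q = length U - 1"
  have pairs: "(P, U) \<in> outer_pairs m" "(P', U) \<in> outer_pairs m"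
    using steps Reverse_Insert by auto
  obtain G where G: "growth m (length P - 1) q G"
    "P = growth_row G (length P - 1) q" "U = growth_col G q (length P - 1)"
    using outer_pair_growth[OF pairs(1)] unfolding q_def by blast
  obtain G' where G': "growth m (length P' - 1) q G'"
    "P' = growth_row G' (length P' - 1) q" "U = growth_col G' q (length P' - 1)"
    using outer_pair_growth[OF pairs(2)] unfolding q_def by blast
  have last: "G i (length P - 1) = G' i (length P' - 1)" if "i \<le> q" for i
    using that G(3) G'(3) growth_col_simps(2) by metis
  have "i \<le> q \<Longrightarrow> E (growth_row G (length P - 1) i) (growth_row G' (length P' - 1) i)" for i
  proof (induction "q - i" arbitrary: i)
    case 0
    then show ?case using PP' G(2) G'(2) by simp
  next
    case (Suc n)
    then show ?case
      using closed_under_strip_insert(2)[OF E growth_strip_insert[OF G(1)] growth_strip_insert[OF G'(1)], of i i]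
        last by simp
  qed
  moreover have "T = growth_row G (length P - 1) 0" "T' = growth_row G' (length P' - 1) 0"
    using steps Reverse_Insert reverse_column_insert_growth[OF G(1)]
      reverse_column_insert_growth[OF G'(1)] G(2,3) G'(2,3) by simp_all
  ultimately show ?thesis by simp
qed

lemma dual_equivalent_by_same_shape: "dual_equivalent_by step P P' \<Longrightarrow> same_shape P P'"
  by (simp add: dual_equivalent_by_def)

text \<open>Each relation is respected by its own box moves, hence by those of the other kind and by
  all moves built from them, so it can serve as invariant in \<open>dual_equivalent_byI\<close> for
  the other relation.\<close>

lemma C_dual_equivalent_iff_dual_equivalent: "C_dual_equivalent m P P' \<longleftrightarrow> dual_equivalent m P P'"
proof
  assume "C_dual_equivalent m P P'"
  then show "dual_equivalent m P P'"
    unfolding dual_equivalent_def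
  proof (rule dual_equivalent_byI[rotated -1])
    show "C_dual_equivalent m T T'"
      if "slide_step m a X T" "slide_step m a X' T'" "C_dual_equivalent m X X'" for a X X' T T'
      using closed_under_remove_move[OF C_dual_equivalent_closed] that by (rule closed_under_slide_step)
  qed (simp add: C_dual_equivalent_def dual_equivalent_by_same_shape)
next
  assume "dual_equivalent m P P'"
  then show "C_dual_equivalent m P P'"
    unfolding C_dual_equivalent_def
  proof (rule dual_equivalent_byI[rotated -1])
    show "dual_equivalent m T T'"
      if "insertion_step m a X T" "insertion_step m a X' T'" "dual_equivalent m X X'" for a X X' T T'
      using closed_under_add_move[OF dual_equivalent_closed] that by (rule closed_under_insertion_step)
  qed (simp add: dual_equivalent_def dual_equivalent_by_same_shape)
qed

section \<open>Knuth equivalence\<close>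

lemma steps_append: "steps step as P X \<Longrightarrow> steps step bs X T \<Longrightarrow> steps step (as @ bs) P T"
  by (induction rule: steps.induct) (auto intro: steps.intros)

lemma Knuth_equivalent_refl: "Knuth_equivalent m P P"
  unfolding Knuth_equivalent_def using steps.Nil by blast

lemma Knuth_equivalent_trans:
  "Knuth_equivalent m P X \<Longrightarrow> Knuth_equivalent m X T \<Longrightarrow> Knuth_equivalent m P T"
  unfolding Knuth_equivalent_def using steps_append by blast

lemma Knuth_equivalent_slide_step: "slide_step m a P T \<Longrightarrow> Knuth_equivalent m P T"
  unfolding Knuth_equivalent_def
  by (rule exI[of _ "[a]"]) (rule steps.Cons[of "slide_step m", OF _ steps.Nil])

text \<open>Both directions are recorded because the insertion of a box is simulated by slides to a
  translate followed by reverse slides.\<close>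

lemma remove_moves_Knuth:
  "move_path (remove_move m) rs rs' P T \<Longrightarrow> Knuth_equivalent m P T \<and> Knuth_equivalent m T P"
proof (induction rule: move_path.induct)
  case (Nil P)
  then show ?case by (simp add: Knuth_equivalent_refl)
next
  case (snoc rs rs' P X r r' T)
  then show ?case
    using remove_move_slide_step[OF snoc.hyps(2)] Knuth_equivalent_slide_step Knuth_equivalent_trans
    by blast
qed

lemma add_move_Knuth:
  assumes "add_move m r r' P T"
  shows "Knuth_equivalent m P T"
proof -
  obtain X where "Knuth_equivalent m P X" "Knuth_equivalent m X T"
    using add_move_by_remove_moves[OF assms] remove_moves_Knuth by blast
  then show ?thesis by (rule Knuth_equivalent_trans)
qed

lemma add_moves_Knuth: "move_path (add_move m) rs rs' P T \<Longrightarrow> Knuth_equivalent m P T"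
  by (induction rule: move_path.induct)
    (auto intro: Knuth_equivalent_refl Knuth_equivalent_trans add_move_Knuth)

lemma growth_Knuth:
  assumes "growth m p q G"
  shows "i \<le> q \<Longrightarrow> Knuth_equivalent m (growth_row G p 0) (growth_row G p i)"
proof (induction i)
  case 0
  show ?case by (rule Knuth_equivalent_refl)
next
  case (Suc i)
  then have "strip_insert m (growth_row G p i) (growth_row G p (Suc i))"
    using growth_strip_insert[OF assms] by simp
  then show ?case
    using Suc strip_insert_path add_moves_Knuth Knuth_equivalent_trans by (meson Suc_leD)
qed

lemma column_insert_Knuth:
  assumes "(P, Q) \<in> inner_pairs m" "column_insert (P, Q) = (T, U)"
  shows "Knuth_equivalent m P T \<and> Knuth_equivalent m Q U \<and>
    outer_border P = inner_border U \<and> outer_border Q = inner_border T"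
proof -
  define p q where "p = length P - 1" and "q = length Q - 1"
  obtain G where G: "growth m p q G" "P = growth_row G p 0" "Q = growth_col G q 0"
    using inner_pair_growth[OF assms(1)] unfolding p_def q_def by blast
  have T: "T = growth_row G p q" and U: "U = growth_col G q p"
    using column_insert_growth[OF G(1)] assms(2) G(2,3) by simp_all
  have col: "growth_row (\<lambda>i j. G j i) q j = growth_col G q j" for j
    by (simp add: growth_row_def growth_col_def)
  have "Knuth_equivalent m P T" unfolding G(2) T by (rule growth_Knuth[OF G(1)]) simp
  \<comment> \<open>The local rule is symmetric in \<open>\<beta>\<close> and
    \<open>\<gamma>\<close>, so the transposed array is a growth diagram with \<open>Q\<close> and
    \<open>U\<close> as first and last rows.\<close>
  moreover have "Knuth_equivalent m Q U"
    using growth_Knuth[OF growth_transpose[OF G(1)], of p] unfolding G(3) U by (simp add: col)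
  moreover have "outer_border P = inner_border U" "outer_border Q = inner_border T"
    unfolding G(2,3) T U by simp_all
  ultimately show ?thesis by simp
qed

theorem theorem5p3:
  fixes m :: nat
  assumes "m \<ge> 1"
  shows "bij_betw column_insert (inner_pairs m) (outer_pairs m) \<and>
    (\<forall>x \<in> inner_pairs m. reverse_column_insert (column_insert x) = x) \<and>
    (\<forall>y \<in> outer_pairs m. column_insert (reverse_column_insert y) = y) \<and>
    (\<forall>P Q T U. (P, Q) \<in> inner_pairs m \<longrightarrow> column_insert (P, Q) = (T, U) \<longrightarrow>
       Knuth_equivalent m P T \<and> Knuth_equivalent m Q U \<and>
       outer_border P = inner_border U \<and> outer_border Q = inner_border T) \<and>
    (\<forall>P Q. is_tableau m P \<longrightarrow> is_tableau m Q \<longrightarrow>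
       (C_dual_equivalent m P Q \<longleftrightarrow> dual_equivalent m P Q))"
proof (intro conjI ballI allI impI)
  show "bij_betw column_insert (inner_pairs m) (outer_pairs m)" by (rule bij_betw_column_insert)
  show "reverse_column_insert (column_insert x) = x" if "x \<in> inner_pairs m" for x
    using reverse_column_insert_column_insert(2)[OF that] .
  show "column_insert (reverse_column_insert y) = y" if "y \<in> outer_pairs m" for y
    using column_insert_reverse_column_insert(2)[OF that] .
  fix P Q T U
  assume "(P, Q) \<in> inner_pairs m" "column_insert (P, Q) = (T, U)"
  from column_insert_Knuth[OF this]
  show "Knuth_equivalent m P T" "Knuth_equivalent m Q U" "outer_border P = inner_border U"
    "outer_border Q = inner_border T" by simp_all
next
  show "C_dual_equivalent m P Q \<longleftrightarrow> dual_equivalent m P Q" for P Q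
    by (rule C_dual_equivalent_iff_dual_equivalent)
qed

end
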